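(* Let $n\ge2$ and let $M=\Gamma\backslash\mathbb{H}^n$ be a compact hyperbolic manifold, with $\Gamma\subset SO_o(n,1)$ discrete, torsion-free and cocompact. If $M$ contains an orientable, compact, totally geodesic hypersurface $\Sigma$, then $H^1(\Gamma,S^k_0\mathbb{R}^{n+1})\neq0$ for every $k\ge1$.
   Context: $SO(n,1)$ is the group of determinant-one linear maps preserving $h(x,x)=x_1^2+\dots+x_n^2-x_{n+1}^2$ on $\mathbb{R}^{n+1}$, acting on $\mathbb{H}^n=\{h(x,x)=-1,x_{n+1}>0\}$ with the induced metric. $S^k_0\mathbb{R}^{n+1}$ denotes the $SO(n,1)$-module given by the trace-free part (trace taken with $h$) of the $k$th symmetric power of $\mathbb{R}^{n+1}$; $\Gamma$ acts by restriction, and $H^1$ denotes group cohomology. *)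

theory Defs
  imports "HOL-Analysis.Analysis"
begin

text \<open>Model: R^(n+1) is real^('n option), n = CARD('n); the coordinate None is the
  time coordinate x_(n+1). Matrices act by matrix-vector product.\<close>

type_synonym 'n vec1 = "real ^ ('n option)"
type_synonym 'n mat1 = "real ^ ('n option) ^ ('n option)"

definition lor :: "('n::finite) vec1 \<Rightarrow> 'n vec1 \<Rightarrow> real" where
  "lor x y = (\<Sum>i\<in>UNIV. (if i = None then - 1 else 1) * (x $ i * y $ i))"

definition hyp_space :: "('n::finite) vec1 set" where
  "hyp_space = {x. lor x x = -1 \<and> x $ None > 0}"

definition SO_n1 :: "('n::finite) mat1 set" where
  "SO_n1 = {A. det A = 1 \<and> (\<forall>x y. lor (A *v x) (A *v y) = lor x y)}"

text \<open>Identity component SO_o(n,1).\<close>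
definition SO0_n1 :: "('n::finite) mat1 set" where
  "SO0_n1 = connected_component_set SO_n1 (mat 1)"

definition mpow :: "('n::finite) mat1 \<Rightarrow> nat \<Rightarrow> 'n mat1" where
  "mpow A k = (((**) A) ^^ k) (mat 1)"

definition is_subgroup_mat :: "('n::finite) mat1 set \<Rightarrow> bool" where
  "is_subgroup_mat G \<longleftrightarrow> mat 1 \<in> G \<and> (\<forall>A\<in>G. \<forall>B\<in>G. A ** B \<in> G)
     \<and> (\<forall>A\<in>G. invertible A \<and> matrix_inv A \<in> G)"

definition discrete_mat :: "('n::finite) mat1 set \<Rightarrow> bool" where
  "discrete_mat G \<longleftrightarrow> (\<forall>A\<in>G. \<exists>e>0. \<forall>B\<in>G. dist B A < e \<longrightarrow> B = A)"

definition torsion_free :: "('n::finite) mat1 set \<Rightarrow> bool" where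
  "torsion_free G \<longleftrightarrow> (\<forall>A\<in>G. \<forall>k>0. mpow A k = mat 1 \<longrightarrow> A = mat 1)"

text \<open>Cocompact: the quotient Gamma\H^n is compact, i.e. H^n is covered by the
  Gamma-translates of a compact subset of H^n.\<close>
definition cocompact :: "('n::finite) mat1 set \<Rightarrow> bool" where
  "cocompact G \<longleftrightarrow> (\<exists>K. compact K \<and> K \<subseteq> hyp_space \<and>
      (\<Union>A\<in>G. (\<lambda>x. A *v x) ` K) = hyp_space)"

text \<open>Totally geodesic hyperplane of H^n with unit spacelike normal nu.\<close>
definition hyperplane_H :: "('n::finite) vec1 \<Rightarrow> 'n vec1 set" where
  "hyperplane_H \<nu> = {x \<in> hyp_space. lor x \<nu> = 0}"

text \<open>S is the preimage in H^n of an embedded, compact, orientable, totally geodesic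
  hypersurface Sigma of M = Gamma\H^n: a Gamma-invariant, locally finite union of
  pairwise disjoint (or equal) totally geodesic hyperplanes, with compact image
  in M, such that every element of Gamma stabilising one of the hyperplanes
  preserves its unit normal (two-sidedness = orientability, as M is orientable).\<close>
definition orientable_compact_tg_hypersurface ::
    "('n::finite) mat1 set \<Rightarrow> 'n vec1 set \<Rightarrow> bool" where
  "orientable_compact_tg_hypersurface G S \<longleftrightarrow>
    (\<exists>N. N \<noteq> {} \<and> (\<forall>\<nu>\<in>N. lor \<nu> \<nu> = 1) \<and>
      S = (\<Union>\<nu>\<in>N. hyperplane_H \<nu>) \<and>
      (\<forall>A\<in>G. (\<lambda>x. A *v x) ` S = S) \<and>
      (\<forall>\<nu>\<in>N. \<forall>\<mu>\<in>N. hyperplane_H \<nu> = hyperplane_H \<mu> \<or>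
                        hyperplane_H \<nu> \<inter> hyperplane_H \<mu> = {}) \<and>
      (\<forall>K. compact K \<longrightarrow> finite {hyperplane_H \<nu> | \<nu>. \<nu> \<in> N \<and> hyperplane_H \<nu> \<inter> K \<noteq> {}}) \<and>
      (\<exists>K. compact K \<and> K \<subseteq> S \<and> S \<subseteq> (\<Union>A\<in>G. (\<lambda>x. A *v x) ` K)) \<and>
      (\<forall>A\<in>G. \<forall>\<nu>\<in>N. (\<lambda>x. A *v x) ` hyperplane_H \<nu> = hyperplane_H \<nu> \<longrightarrow> A *v \<nu> = \<nu>))"

text \<open>Tensors in (R^(n+1))^{tensor k}: functions of a multi-index (nat => 'n option),
  depending only on the first k entries.\<close>
type_synonym 'n tensor = "(nat \<Rightarrow> 'n option) \<Rightarrow> real"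

definition sym_trfree :: "nat \<Rightarrow> ('n::finite) tensor set" where
  "sym_trfree k = {T.
     (\<forall>f g. (\<forall>m<k. f m = g m) \<longrightarrow> T f = T g) \<and>
     (\<forall>\<sigma> f. \<sigma> permutes {..<k} \<longrightarrow> T (f \<circ> \<sigma>) = T f) \<and>
     (k \<ge> 2 \<longrightarrow> (\<forall>f. (\<Sum>i\<in>UNIV. (if i = None then - 1 else 1) * T (f(0 := i, 1 := i))) = 0))}"

text \<open>Action of a matrix on k-tensors: (A.T)^{i_1..i_k} = sum A^{i_1}_{j_1}...A^{i_k}_{j_k} T^{j_1..j_k}.\<close>
definition tensor_act :: "nat \<Rightarrow> ('n::finite) mat1 \<Rightarrow> 'n tensor \<Rightarrow> 'n tensor" where
  "tensor_act k A T = (\<lambda>f. \<Sum>g\<in>PiE {..<k} (\<lambda>_. UNIV). (\<Prod>m<k. A $ (f m) $ (g m)) * T g)"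

text \<open>H^1(G, V) \<noteq> 0: there is a 1-cocycle (crossed homomorphism) that is not a coboundary.\<close>
definition H1_nonzero :: "('n::finite) mat1 set \<Rightarrow> nat \<Rightarrow> bool" where
  "H1_nonzero G k \<longleftrightarrow> (\<exists>c. (\<forall>A\<in>G. c A \<in> sym_trfree k) \<and>
      (\<forall>A\<in>G. \<forall>B\<in>G. c (A ** B) = (\<lambda>f. c A f + tensor_act k A (c B) f)) \<and>
      \<not> (\<exists>v\<in>sym_trfree k. \<forall>A\<in>G. c A = (\<lambda>f. tensor_act k A v f - v f)))"

end

theory Submission
  imports Defs "HOL-Computational_Algebra.Polynomial"
begin

text \<open>For a unit normal \<open>\<nu>\<close> let \<open>Z\<^sub>\<nu>\<close> be the trace-free part of \<open>\<nu>\<^sup>k\<close>, that is, the zonal harmonic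
  of degree \<open>k\<close> about \<open>\<nu>\<close>. Fix one wall \<open>H\<close> over the hypersurface. Summing \<open>\<plusminus>Z\<^sub>\<nu>\<close> over the
  translates of \<open>H\<close> crossed on the way from \<open>x\<^sub>0\<close> to \<open>A x\<^sub>0\<close> gives a cocycle.

  If it is a coboundary, it integrates to an equivariant function \<open>F\<close> on hyperbolic space which is
  constant on each component of the complement of the walls and on each wall, and jumps by \<open>Z\<^sub>\<nu>\<close> across the wall with normal \<open>\<nu>\<close>.
  By equivariance and cocompactness the value of \<open>F\<close> at \<open>x\<close> is a bounded tensor when it is measured in
  an orthonormal frame at \<open>x\<close>. As \<open>F\<close> is constant on a wall, its polynomial restricted to the
  geodesics of the wall is a bounded Laurent polynomial in \<open>e\<^sup>t\<close>, hence constant; so this polynomial is on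
  hyperbolic space a function of \<open>lor y \<nu>\<close> alone. Now consider the value \<open>P\<close> of \<open>F\<close> on
  one side of a wall. If there is another wall on that side, with normal \<open>\<mu>\<close> and met first, then \<open>P\<close> is a
  function of \<open>lor y \<nu>\<close> and also of \<open>lor y \<mu>\<close>; if there is none, then \<open>P\<close> is bounded on a
  half-space. Either way \<open>P\<close> is constant on a geodesic along which \<open>lor y \<nu>\<close> varies, hence
  constant on hyperbolic space. This applies to both sides, so their difference \<open>Z\<^sub>\<nu>\<close> is
  constant, which is false for \<open>k \<ge> 1\<close>.\<close>

subsection \<open>Symmetric tensors and their polynomials\<close>

definition depends_below :: "nat \<Rightarrow> ('n::finite) tensor \<Rightarrow> bool" where
  "depends_below k T \<longleftrightarrow> (\<forall>f g. (\<forall>m<k. f m = g m) \<longrightarrow> T f = T g)"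

definition symmetric_tensor :: "nat \<Rightarrow> ('n::finite) tensor \<Rightarrow> bool" where
  "symmetric_tensor k T \<longleftrightarrow> (\<forall>\<sigma> f. \<sigma> permutes {..<k} \<longrightarrow> T (f \<circ> \<sigma>) = T f)"

text \<open>The homogeneous polynomial of \<open>T\<close>. Extensional functions count each
  multi-index of length \<open>k\<close> once, although tensors take infinite index
  sequences.\<close>

definition tensor_form :: "nat \<Rightarrow> ('n::finite) tensor \<Rightarrow> 'n vec1 \<Rightarrow> real" where
  "tensor_form k T y = (\<Sum>f\<in>PiE {..<k} (\<lambda>_. UNIV). (\<Prod>m<k. y $ f m) * T f)"

text \<open>Peels off one index, for induction on the degree; for symmetric tensors this is, up to a
  factor, a partial derivative of the polynomial.\<close>

definition fix_first :: "'n option \<Rightarrow> ('n::finite) tensor \<Rightarrow> 'n tensor" where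
  "fix_first i T = (\<lambda>f. T (case_nat i f))"

text \<open>The empty product space contains only the function that is \<open>undefined\<close>
  everywhere.\<close>

lemma tensor_form_0 [simp]: "tensor_form 0 T y = T (\<lambda>_. undefined)"
  by (simp add: tensor_form_def)

lemma tensor_form_Suc: "tensor_form (Suc k) T y
    = (\<Sum>i\<in>UNIV. y $ i * tensor_form k (fix_first i T) y)"
proof -
  have bij: "bij_betw (\<lambda>(i,f). case_nat i f) (UNIV \<times> PiE {..<k} (\<lambda>_. UNIV :: 'a option set))
          (PiE {..<Suc k} (\<lambda>_. UNIV))"
    by (rule bij_betw_byWitness[where f' = "\<lambda>g. (g 0, g \<circ> Suc)"])
      (auto simp: PiE_iff extensional_def fun_eq_iff split: nat.splits)
  have "tensor_form (Suc k) T y = (\<Sum>(i,f)\<in>UNIV \<times> PiE {..<k} (\<lambda>_. UNIV).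
          (\<Prod>m<Suc k. y $ (case_nat i f m)) * T (case_nat i f))"
    unfolding tensor_form_def by (subst sum.reindex_bij_betw[OF bij, symmetric]) (simp add: case_prod_beta)
  also have "\<dots> = (\<Sum>i\<in>UNIV. \<Sum>f\<in>PiE {..<k} (\<lambda>_. UNIV). y $ i * ((\<Prod>m<k. y $ f m) * T (case_nat i f)))"
    by (subst sum.cartesian_product[symmetric])
      (simp only: prod.lessThan_Suc_shift nat.case mult.assoc o_def)
  also have "\<dots> = (\<Sum>i\<in>UNIV. y $ i * tensor_form k (fix_first i T) y)"
    by (simp add: tensor_form_def fix_first_def sum_distrib_left)
  finally show ?thesis .
qed

lemma depends_below_fix_first: "depends_below (Suc k) T \<Longrightarrow> depends_below k (fix_first i T)"
  unfolding depends_below_def fix_first_def by (auto simp: less_Suc_eq_0_disj split: nat.splits)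

lemma permutes_case_nat:
  assumes "\<sigma> permutes {..<k}"
  shows "case_nat 0 (Suc \<circ> \<sigma>) permutes {..<Suc k}"
proof (rule bij_imp_permutes)
  have in1: "\<sigma> m < k \<longleftrightarrow> m < k" "inv \<sigma> m < k \<longleftrightarrow> m < k" for m
    using permutes_in_image[OF assms, of m] permutes_in_image[OF permutes_inv[OF assms], of m]
    by auto
  show "bij_betw (case_nat 0 (Suc \<circ> \<sigma>)) {..<Suc k} {..<Suc k}"
    by (rule bij_betw_byWitness[where f' = "case_nat 0 (Suc \<circ> inv \<sigma>)"])
      (auto simp: in1 permutes_inverses[OF assms] split: nat.splits)
  show "case_nat 0 (Suc \<circ> \<sigma>) x = x" if "x \<notin> {..<Suc k}" for x
    using that permutes_not_in[OF assms] by (cases x) auto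
qed

lemma symmetric_tensor_fix_first:
  assumes "symmetric_tensor (Suc k) T" shows "symmetric_tensor k (fix_first i T)"
  unfolding symmetric_tensor_def
proof (intro allI impI)
  fix \<sigma> and f :: "nat \<Rightarrow> 'a option" assume "\<sigma> permutes {..<k}"
  moreover have "case_nat i (f \<circ> \<sigma>) = case_nat i f \<circ> case_nat 0 (Suc \<circ> \<sigma>)"
    by (auto simp: fun_eq_iff split: nat.splits)
  ultimately show "fix_first i T (f \<circ> \<sigma>) = fix_first i T f"
    using assms permutes_case_nat unfolding fix_first_def symmetric_tensor_def by metis
qed

lemma fix_first_commute:
  assumes "symmetric_tensor (Suc (Suc k)) T"
  shows "fix_first i (fix_first j T) = fix_first j (fix_first i T)"
proof
  fix f
  have "Transposition.transpose 0 1 permutes {..<Suc (Suc k)}" by (rule permutes_swap_id) auto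
  moreover have "case_nat i (case_nat j f)
      = case_nat j (case_nat i f) \<circ> Transposition.transpose 0 1"
    by (auto simp: fun_eq_iff Transposition.transpose_def split: nat.splits)
  ultimately show "fix_first i (fix_first j T) f = fix_first j (fix_first i T) f"
    using assms unfolding fix_first_def symmetric_tensor_def by metis
qed

text \<open>Split off one slot and use the product rule: this slot contributes one copy of the form
  on the right, and by induction each remaining slot contributes another. Symmetry lets the two
  fixed indices be exchanged.\<close>

lemma tensor_form_has_derivative:
  assumes "symmetric_tensor (Suc k) T"
  shows "((\<lambda>t. tensor_form (Suc k) T (y + t *\<^sub>R axis i 1)) has_real_derivative
    Suc k * tensor_form k (fix_first i T) (y + t *\<^sub>R axis i 1)) (at t)"
  using assms
proof (induction k arbitrary: T)
  case 0
  have "((\<lambda>t. (y + t *\<^sub>R axis i 1) $ j * c) has_real_derivative axis i 1 $ j * c) (at t)" for j c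
    by (auto intro!: derivative_eq_intros)
  then have "((\<lambda>t. tensor_form (Suc 0) T (y + t *\<^sub>R axis i 1)) has_real_derivative
     (\<Sum>j\<in>UNIV. axis i 1 $ j * tensor_form 0 (fix_first j T) y)) (at t)"
    unfolding tensor_form_Suc tensor_form_0 by (intro DERIV_sum)
  then show ?case by (simp add: axis_def if_distrib[of "\<lambda>x. x * _"] cong: if_cong)
next
  case (Suc k)
  let ?y = "y + t *\<^sub>R axis i 1"
  have "((\<lambda>t. (y + t *\<^sub>R axis i 1) $ j) has_real_derivative axis i 1 $ j) (at t)" for j
    by (auto intro!: derivative_eq_intros)
  then have "((\<lambda>t. tensor_form (Suc (Suc k)) T (y + t *\<^sub>R axis i 1)) has_real_derivative
     (\<Sum>j\<in>UNIV. ?y $ j * (Suc k * tensor_form k (fix_first i (fix_first j T)) ?y)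
        + axis i 1 $ j * tensor_form (Suc k) (fix_first j T) ?y)) (at t)"
    unfolding tensor_form_Suc[of "Suc k"]
    by (intro DERIV_sum DERIV_mult' Suc.IH[OF symmetric_tensor_fix_first[OF Suc.prems]])
  also have "(\<Sum>j\<in>UNIV. ?y $ j * (Suc k * tensor_form k (fix_first i (fix_first j T)) ?y)
        + axis i 1 $ j * tensor_form (Suc k) (fix_first j T) ?y)
     = Suc k * (\<Sum>j\<in>UNIV. ?y $ j * tensor_form k (fix_first i (fix_first j T)) ?y)
        + (\<Sum>j\<in>UNIV. axis i 1 $ j * tensor_form (Suc k) (fix_first j T) ?y)"
    unfolding sum.distrib sum_distrib_left by (simp only: mult.left_commute)
  also have "(\<Sum>j\<in>UNIV. axis i 1 $ j * tensor_form (Suc k) (fix_first j T) ?y)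
      = tensor_form (Suc k) (fix_first i T) ?y"
    by (simp add: axis_def if_distrib[of "\<lambda>x. x * _"] cong: if_cong)
  also have "(\<Sum>j\<in>UNIV. ?y $ j * tensor_form k (fix_first i (fix_first j T)) ?y)
      = tensor_form (Suc k) (fix_first i T) ?y"
    unfolding tensor_form_Suc fix_first_commute[OF Suc.prems, of i] by (rule refl)
  finally show ?case by (simp add: distrib_right)
qed

text \<open>The partial derivatives of a vanishing form vanish, and up to a nonzero factor they are
  the forms of the tensors with one index fixed; this strips the indices one at a time.\<close>

lemma tensor_form_eq_0D:
  assumes "depends_below k T" "symmetric_tensor k T" "\<And>y. tensor_form k T y = 0"
  shows "T f = 0"
  using assms
proof (induction k arbitrary: T f)
  case 0
  then show ?case unfolding depends_below_def by (metis less_nat_zero_code tensor_form_0)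
next
  case (Suc k)
  have "tensor_form k (fix_first i T) y = 0" for i y
    using DERIV_unique[OF tensor_form_has_derivative[OF Suc.prems(2), of y i 0], of 0] Suc.prems(3) by simp
  then have "fix_first (f 0) T (f \<circ> Suc) = 0"
    using Suc.IH[OF depends_below_fix_first symmetric_tensor_fix_first, OF Suc.prems(1,2)] by blast
  moreover have "case_nat (f 0) (f \<circ> Suc) = f" by (auto simp: fun_eq_iff split: nat.splits)
  ultimately show ?case by (simp add: fix_first_def)
qed

lemma tensor_form_add: "tensor_form k (\<lambda>f. T f + U f) y = tensor_form k T y + tensor_form k U y"
  by (simp add: tensor_form_def algebra_simps sum.distrib)

lemma tensor_form_diff: "tensor_form k (\<lambda>f. T f - U f) y = tensor_form k T y - tensor_form k U y"
  by (simp add: tensor_form_def algebra_simps sum_subtractf)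

lemma tensor_form_scale: "tensor_form k (\<lambda>f. c * T f) y = c * tensor_form k T y"
  by (simp add: tensor_form_def sum_distrib_left mult_ac)

lemma tensor_form_sum: "tensor_form k (\<lambda>f. \<Sum>i\<in>I. T i f) y = (\<Sum>i\<in>I. tensor_form k (T i) y)"
  by (simp add: tensor_form_def sum_distrib_left) (rule sum.swap)

lemma tensor_form_inject:
  assumes "depends_below k T" "symmetric_tensor k T" "depends_below k U" "symmetric_tensor k U"
      "\<And>y. tensor_form k T y = tensor_form k U y"
  shows "T = U"
proof
  fix f
  have "depends_below k (\<lambda>f. T f - U f)" "symmetric_tensor k (\<lambda>f. T f - U f)"
    using assms(1-4) unfolding depends_below_def symmetric_tensor_def by metis+
  from tensor_form_eq_0D[OF this, of f] show "T f = U f" using assms(5)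
      by (simp add: tensor_form_diff)
qed

lemma tensor_form_homogeneous: "tensor_form k T (c *\<^sub>R y) = c ^ k * tensor_form k T y"
  by (simp add: tensor_form_def prod.distrib sum_distrib_left mult_ac)

lemma continuous_tensor_form: "continuous_on X (tensor_form k T)"
  unfolding tensor_form_def by (intro continuous_intros)

lemma tensor_form_curve_poly: "\<exists>p. \<forall>u. tensor_form k T (a + u *\<^sub>R b + u\<^sup>2 *\<^sub>R c) = poly p u"
proof -
  have "tensor_form k T (a + u *\<^sub>R b + u\<^sup>2 *\<^sub>R c) = poly (\<Sum>f\<in>PiE {..<k} (\<lambda>_. UNIV).
      smult (T f) (\<Prod>m<k. [:a $ f m, b $ f m, c $ f m:])) u" for u
    by (simp add: tensor_form_def poly_sum poly_prod algebra_simps power2_eq_square)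
  then show ?thesis by blast
qed

lemma sum_PiE_permute:
  assumes "\<sigma> permutes I"
  shows "(\<Sum>g\<in>PiE I (\<lambda>_. B). F (g \<circ> \<sigma>)) = (\<Sum>g\<in>PiE I (\<lambda>_. B). F g)"
proof -
  have "bij_betw (\<lambda>g. g \<circ> \<sigma>) (PiE I (\<lambda>_. B)) (PiE I (\<lambda>_. B))"
    using assms permutes_inv[OF assms]
    by (intro bij_betw_byWitness[where f' = "\<lambda>g. g \<circ> inv \<sigma>"])
      (auto simp: PiE_iff extensional_def comp_assoc permutes_inv_o permutes_not_in permutes_in_image)
  from sum.reindex_bij_betw[OF this, of F] show ?thesis .
qed

lemma tensor_form_precompose_perm:
  assumes "\<sigma> permutes {..<k}"
  shows "tensor_form k (\<lambda>f. T (f \<circ> \<sigma>)) y = tensor_form k T y"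
proof -
  have "(\<Prod>m<k. y $ f m) = (\<Prod>m<k. y $ (f \<circ> \<sigma>) m)" for f
    using prod.permute[OF assms, of "\<lambda>m. y $ f m"] by (simp add: o_def)
  then show ?thesis
    unfolding tensor_form_def by (subst sum_PiE_permute[OF assms, symmetric]) simp
qed

section \<open>Symmetrization, and polynomials that are forms of tensors\<close>

definition symmetrize :: "nat \<Rightarrow> ('n::finite) tensor \<Rightarrow> 'n tensor" where
  "symmetrize k T = (\<lambda>f. (1 / fact k) * (\<Sum>\<sigma> | \<sigma> permutes {..<k}. T (f \<circ> \<sigma>)))"

lemma tensor_form_symmetrize: "tensor_form k (symmetrize k T) y = tensor_form k T y"
  unfolding symmetrize_def tensor_form_scale tensor_form_sum
  by (simp add: tensor_form_precompose_perm card_permutations[of _ k])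

lemma symmetric_tensor_symmetrize: "symmetric_tensor k (symmetrize k T)"
  unfolding symmetric_tensor_def symmetrize_def
proof (intro allI impI)
  fix \<tau> and f :: "nat \<Rightarrow> 'a option" assume "\<tau> permutes {..<k}"
  from setum_permutations_compose_left[OF this, of "\<lambda>\<sigma>. T (f \<circ> \<sigma>)"]
  show "(1 / fact k) * (\<Sum>\<sigma> | \<sigma> permutes {..<k}. T ((f \<circ> \<tau>) \<circ> \<sigma>))
      = (1 / fact k) * (\<Sum>\<sigma> | \<sigma> permutes {..<k}. T (f \<circ> \<sigma>))"
    by (simp add: comp_assoc)
qed

lemma depends_below_symmetrize:
  assumes "depends_below k T" shows "depends_below k (symmetrize k T)"
proof -
  have "T (f \<circ> \<sigma>) = T (g \<circ> \<sigma>)" if "\<forall>m<k. f m = g m" "\<sigma> permutes {..<k}" for f g \<sigma>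
    using assms that permutes_in_image[OF that(2)] unfolding depends_below_def
        by (metis comp_def lessThan_iff)
  then show ?thesis unfolding depends_below_def symmetrize_def by (auto intro!: sum.cong)
qed

text \<open>Products are easy to represent by arbitrary tensors; \<open>symmetrize\<close> yields a
  symmetric representative afterwards.\<close>

definition is_form :: "nat \<Rightarrow> (('n::finite) vec1 \<Rightarrow> real) \<Rightarrow> bool" where
  "is_form k P \<longleftrightarrow> (\<exists>T. depends_below k T \<and> P = tensor_form k T)"

lemma is_form_const: "is_form 0 (\<lambda>_. c)"
  unfolding is_form_def by (rule exI[of _ "\<lambda>_. c"]) (auto simp: depends_below_def)

lemma is_form_linear:
  assumes "is_form k P" shows "is_form (Suc k) (\<lambda>y. (y \<bullet> a) * P y)"
proof -
  from assms obtain T where T: "depends_below k T" "P = tensor_form k T" unfolding is_form_def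
      by blast
  let ?U = "\<lambda>f. a $ f 0 * T (f \<circ> Suc)"
  have "tensor_form (Suc k) ?U y = (y \<bullet> a) * P y" for y
    by (simp add: tensor_form_Suc T(2) inner_vec_def fix_first_def tensor_form_scale sum_distrib_right o_def mult.assoc)
  moreover have "?U f = ?U g" if "\<forall>m<Suc k. f m = g m" for f g
    using T(1) that unfolding depends_below_def by (metis Suc_mono comp_def zero_less_Suc)
  ultimately show ?thesis unfolding is_form_def depends_below_def by (intro exI[of _ ?U]) auto
qed

lemma is_form_scale:
  assumes "is_form k P" shows "is_form k (\<lambda>y. c * P y)"
proof -
  from assms obtain T where "depends_below k T" "P = tensor_form k T" unfolding is_form_def by blast
  then show ?thesis unfolding is_form_def depends_below_def
    by (intro exI[of _ "\<lambda>f. c * T f"]) (auto simp: tensor_form_scale fun_eq_iff intro: arg_cong)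
qed

lemma is_form_sum:
  assumes "\<And>i. i \<in> I \<Longrightarrow> is_form k (P i)" shows "is_form k (\<lambda>y. \<Sum>i\<in>I. P i y)"
proof -
  from assms obtain T where T: "\<And>i. i \<in> I \<Longrightarrow> depends_below k (T i) \<and> P i = tensor_form k (T i)"
    unfolding is_form_def by metis
  have "depends_below k (\<lambda>f. \<Sum>i\<in>I. T i f)"
    using T unfolding depends_below_def by (auto intro!: sum.cong)
  then show ?thesis unfolding is_form_def using T
    by (intro exI[of _ "\<lambda>f. \<Sum>i\<in>I. T i f"]) (auto simp: tensor_form_sum fun_eq_iff)
qed

lemma is_form_linear_power:
  assumes "is_form k P" shows "is_form (j + k) (\<lambda>y. (y \<bullet> a) ^ j * P y)"
proof (induction j)
  case (Suc j)
  then show ?case using is_form_linear[OF Suc, of a] by (simp add: mult_ac)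
qed (use assms in simp)

text \<open>Polynomials are evaluated on covectors: \<open>y $ i\<close> stands for \<open>x $ i\<close> with its index
  lowered by the form, so that the polynomial of \<open>\<nu>\<^sup>k\<close> at \<open>x\<close> is \<open>lor x \<nu> ^ k\<close>.\<close>

definition lor_sign :: "'n option \<Rightarrow> real" where "lor_sign i = (if i = None then - 1 else 1)"

definition lower :: "('n::finite) vec1 \<Rightarrow> 'n vec1" where "lower x = (\<chi> i. lor_sign i * x $ i)"

definition lor_quad :: "('n::finite) vec1 \<Rightarrow> real" where "lor_quad y
    = (\<Sum>i\<in>UNIV. lor_sign i * (y $ i)\<^sup>2)"

lemma lor_sign_sq [simp]: "lor_sign i * lor_sign i = 1" "lor_sign i * (lor_sign i * r) = r"
  by (auto simp: lor_sign_def)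

lemma lor_lower: "lor x y = lower x \<bullet> y"
  by (simp add: lor_def lower_def inner_vec_def lor_sign_def mult_ac)

lemma lor_quad_lower: "lor_quad (lower x) = lor x x"
  unfolding lor_quad_def lor_lower lower_def inner_vec_def
  by (intro sum.cong) (auto simp: lor_sign_def power2_eq_square)

lemma lower_lower [simp]: "lower (lower x) = x"
  by (simp add: lower_def vec_eq_iff)

lemma is_form_lor_quad:
  assumes "is_form k P" shows "is_form (Suc (Suc k)) (\<lambda>y. lor_quad y * P y)"
proof -
  have "is_form (Suc (Suc k)) (\<lambda>y. \<Sum>i\<in>UNIV. lor_sign i * ((y \<bullet> axis i 1) * ((y \<bullet> axis i 1) * P y)))"
    by (intro is_form_sum is_form_scale is_form_linear assms)
  also have "(\<lambda>y. \<Sum>i\<in>UNIV. lor_sign i * ((y \<bullet> axis i 1) * ((y \<bullet> axis i 1) * P y)))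
      = (\<lambda>y. lor_quad y * P y)"
    by (simp add: lor_quad_def inner_axis sum_distrib_right power2_eq_square mult.assoc)
  finally show ?thesis .
qed

lemma is_form_lor_quad_power:
  assumes "is_form k P" shows "is_form (2 * j + k) (\<lambda>y. lor_quad y ^ j * P y)"
proof (induction j)
  case (Suc j)
  then show ?case using is_form_lor_quad[OF Suc] by (simp add: mult_ac)
qed (use assms in simp)

text \<open>Coefficients of the Gegenbauer polynomial, normalized to be monic; the recursion makes
  the Laplacian of the zonal polynomial telescope.\<close>

fun gegenbauer_coeff :: "nat \<Rightarrow> nat \<Rightarrow> nat \<Rightarrow> real" where
  "gegenbauer_coeff d k 0 = 1"
| "gegenbauer_coeff d k (Suc b) = - gegenbauer_coeff d k b * ((real k - 2 * real b) * (real k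
    - 2 * real b - 1)) /
     (2 * (real b + 1) * (2 * real k - 2 * real b - 4 + real d))"

text \<open>The homogenized Gegenbauer polynomial in \<open>y \<bullet> \<nu>\<close>, with
  \<open>lor_quad\<close> as squared length. The subtraction \<open>k - 2 * j\<close> never
  truncates in the range of \<open>j\<close>.\<close>

definition zonal :: "nat \<Rightarrow> ('n::finite) vec1 \<Rightarrow> 'n vec1 \<Rightarrow> real" where
  "zonal k \<nu> y = (\<Sum>j\<le>k div 2. gegenbauer_coeff CARD('n option) k j * ((y \<bullet> \<nu>) ^ (k
      - 2 * j) * lor_quad y ^ j))"

lemma is_form_zonal: "is_form k (zonal k \<nu>)"
proof -
  have "is_form k (\<lambda>y. (y \<bullet> \<nu>) ^ (k - 2 * j) * lor_quad y ^ j)" if "j \<le> k div 2" for j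
  proof -
    have "is_form (k - 2 * j + (2 * j + 0)) (\<lambda>y. (y \<bullet> \<nu>) ^ (k - 2 * j) * (lor_quad y ^ j * 1))"
      by (intro is_form_linear_power is_form_lor_quad_power is_form_const)
    then show ?thesis using that by simp
  qed
  then show ?thesis unfolding zonal_def by (intro is_form_sum is_form_scale) auto
qed

subsection \<open>Zonal harmonics\<close>

text \<open>The Laplacian of the form of \<open>T\<close> is \<open>(k + 2) * (k + 1)\<close> times
  the form of its trace, and a symmetric tensor with vanishing form is zero. The derivatives are
  parameters \<open>P1\<close>, \<open>P2\<close> so that explicit formulas can be supplied.\<close>

lemma trace_free_if_laplacian_0:
  assumes T: "depends_below (Suc (Suc k)) T" "symmetric_tensor (Suc (Suc k)) T"
    and d1: "\<And>i y t. ((\<lambda>t. tensor_form (Suc (Suc k)) T (y + t *\<^sub>R axis i 1)) has_real_derivative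
               P1 i (y + t *\<^sub>R axis i 1)) (at t)"
    and d2: "\<And>i y t. ((\<lambda>t. P1 i (y + t *\<^sub>R axis i 1)) has_real_derivative
               P2 i (y + t *\<^sub>R axis i 1)) (at t)"
    and lap: "\<And>y. (\<Sum>i\<in>UNIV. lor_sign i * P2 i y) = 0"
  shows "(\<Sum>i\<in>UNIV. lor_sign i * T (f(0 := i, 1 := i))) = 0"
proof -
  define U where "U = (\<lambda>f. \<Sum>i\<in>UNIV. lor_sign i * fix_first i (fix_first i T) f)"
  have P1: "P1 i = (\<lambda>y. Suc (Suc k) * tensor_form (Suc k) (fix_first i T) y)" for i
    using DERIV_unique[OF d1 tensor_form_has_derivative[OF T(2)], of i _ 0]
        by (auto simp: fun_eq_iff)
  have P2: "P2 i y = Suc (Suc k) * (Suc k * tensor_form k (fix_first i (fix_first i T)) y)" for i y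
    using DERIV_unique[OF d2[unfolded P1] DERIV_cmult[OF tensor_form_has_derivative[OF symmetric_tensor_fix_first[OF T(2)]]], of i y 0]
    by simp
  have "(\<Sum>i\<in>UNIV. lor_sign i * P2 i y)
      = real (Suc (Suc k)) * real (Suc k) * tensor_form k U y" for y
    unfolding U_def tensor_form_sum tensor_form_scale P2 sum_distrib_left
    by (intro sum.cong) (simp_all only: mult.assoc mult.left_commute)
  then have "tensor_form k U y = 0" for y by (simp add: lap)
  moreover have "depends_below k (fix_first i (fix_first i T))"
      "symmetric_tensor k (fix_first i (fix_first i T))" for i
    using T by (simp_all add: depends_below_fix_first symmetric_tensor_fix_first)
  then have "depends_below k U" "symmetric_tensor k U"
    unfolding U_def depends_below_def symmetric_tensor_def by (auto intro!: sum.cong)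
  ultimately have "U (f \<circ> Suc \<circ> Suc) = 0" by (blast intro: tensor_form_eq_0D)
  moreover have "case_nat i (case_nat i (f \<circ> Suc \<circ> Suc)) = f(0 := i, 1 := i)" for i
    by (auto simp: fun_eq_iff split: nat.splits)
  ultimately show ?thesis by (simp add: U_def fix_first_def)
qed

definition zonal_monom :: "('n::finite) vec1 \<Rightarrow> nat \<Rightarrow> nat \<Rightarrow> 'n vec1 \<Rightarrow> real" where
  "zonal_monom \<nu> a b y = (y \<bullet> \<nu>) ^ a * lor_quad y ^ b"

text \<open>At exponent 0 the truncated \<open>a - 1\<close> or \<open>b - 1\<close> is harmless
  because its factor \<open>a\<close> or \<open>b\<close> is 0.\<close>

definition zonal_monom_d :: "('n::finite) vec1 \<Rightarrow> 'n option \<Rightarrow> nat \<Rightarrow> nat \<Rightarrow> 'n vec1 \<Rightarrow> real" where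
  "zonal_monom_d \<nu> i a b y = a * \<nu> $ i * zonal_monom \<nu> (a - 1) b y
      + 2 * b * lor_sign i * y $ i * zonal_monom \<nu> a (b - 1) y"

definition zonal_monom_dd :: "('n::finite) vec1 \<Rightarrow> 'n option \<Rightarrow> nat \<Rightarrow> nat \<Rightarrow> 'n vec1 \<Rightarrow> real" where
  "zonal_monom_dd \<nu> i a b y = a * \<nu> $ i * zonal_monom_d \<nu> i (a - 1) b y
     + 2 * b * lor_sign i * (zonal_monom \<nu> a (b - 1) y + y $ i * zonal_monom_d \<nu> i a (b - 1) y)"

lemma coord_has_derivative:
  "((\<lambda>t. (y + t *\<^sub>R axis i 1) $ j) has_real_derivative axis i 1 $ j) (at t)"
  by (auto intro!: derivative_eq_intros)

lemma lor_quad_has_derivative: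
  "((\<lambda>t. lor_quad (y + t *\<^sub>R axis i 1))
      has_real_derivative 2 * lor_sign i * (y + t *\<^sub>R axis i 1) $ i) (at t)"
proof -
  have "((\<lambda>t. lor_quad (y + t *\<^sub>R axis i 1)) has_real_derivative
     (\<Sum>j\<in>UNIV. lor_sign j * (2 * (axis i 1 $ j * (y + t *\<^sub>R axis i 1) $ j ^ (2 - Suc 0))))) (at t)"
    unfolding lor_quad_def using DERIV_power[OF coord_has_derivative, where n = 2]
    by (intro DERIV_sum DERIV_cmult) simp
  also have "(\<Sum>j\<in>UNIV. lor_sign j * (2 * (axis i 1 $ j * (y + t *\<^sub>R axis i 1) $ j ^ (2 - Suc 0))))
     = 2 * lor_sign i * (y + t *\<^sub>R axis i 1) $ i"
    by (subst sum.remove[of _ i]) (auto simp: axis_def)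
  finally show ?thesis .
qed

lemma zonal_monom_has_derivative:
  "((\<lambda>t. zonal_monom \<nu> a b (y + t *\<^sub>R axis i 1))
      has_real_derivative zonal_monom_d \<nu> i a b (y + t *\<^sub>R axis i 1)) (at t)"
proof -
  have "((\<lambda>t. (y + t *\<^sub>R axis i 1) \<bullet> \<nu>) has_real_derivative \<nu> $ i) (at t)"
    by (auto intro!: derivative_eq_intros simp: inner_add_left inner_axis')
  note DERIV_mult[OF DERIV_power[OF this, of a] DERIV_power[OF lor_quad_has_derivative, where n = b]]
  moreover have "real a * (\<nu> $ i * ((y + t *\<^sub>R axis i 1) \<bullet> \<nu>) ^ (a - Suc 0)) * lor_quad (y
      + t *\<^sub>R axis i 1) ^ b
      + real b * (2 * lor_sign i * (y + t *\<^sub>R axis i 1) $ i * lor_quad (y + t *\<^sub>R axis i 1) ^ (b - Suc 0))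
        * ((y + t *\<^sub>R axis i 1) \<bullet> \<nu>) ^ a = zonal_monom_d \<nu> i a b (y + t *\<^sub>R axis i 1)"
    unfolding zonal_monom_def zonal_monom_d_def One_nat_def
        by (simp only: mult_ac of_nat_mult of_nat_numeral)
  ultimately show ?thesis unfolding zonal_monom_def by (rule DERIV_cong)
qed

lemma zonal_monom_d_has_derivative:
  "((\<lambda>t. zonal_monom_d \<nu> i a b (y + t *\<^sub>R axis i 1))
      has_real_derivative zonal_monom_dd \<nu> i a b (y + t *\<^sub>R axis i 1)) (at t)"
proof -
  have "((\<lambda>t. (2 * b * lor_sign i) * ((y + t *\<^sub>R axis i 1) $ i * zonal_monom \<nu> a (b - 1) (y
      + t *\<^sub>R axis i 1)))
     has_real_derivative (2 * b * lor_sign i) * ((y + t *\<^sub>R axis i 1) $ i * zonal_monom_d \<nu> i a (b - 1) (y + t *\<^sub>R axis i 1) +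
        axis i 1 $ i * zonal_monom \<nu> a (b - 1) (y + t *\<^sub>R axis i 1))) (at t)"
    by (intro DERIV_cmult DERIV_mult' coord_has_derivative zonal_monom_has_derivative)
  from DERIV_add[OF DERIV_cmult[OF zonal_monom_has_derivative, of "a * \<nu> $ i" \<nu>
      "a - 1" b y i t] this]
  show ?thesis unfolding zonal_monom_d_def[of \<nu> i a b] zonal_monom_dd_def
    by (simp only: mult.assoc of_nat_mult of_nat_numeral axis_nth mult_1_left add.commute[of
        "_ * zonal_monom_d _ _ _ _ _"])
qed

text \<open>Three contractions occur: \<open>\<nu>\<close> with itself, which gives 1,
  \<open>\<nu>\<close> with \<open>y\<close>, and \<open>y\<close> with itself. The number of
  coordinates enters through the second derivative of \<open>lor_quad\<close>.\<close>

lemma laplacian_zonal_monom: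
  fixes \<nu> y :: "('n::finite) vec1"
  assumes "lor \<nu> \<nu> = 1"
  shows "(\<Sum>i\<in>UNIV. lor_sign i * zonal_monom_dd \<nu> i a b y)
      = real a * (real a - 1) * zonal_monom \<nu> (a - 2) b y
     + real b * (4 * real a + 2 * real CARD('n option) + 4 * (real b - 1)) * zonal_monom \<nu> a (b - 1) y"
proof -
  have 1: "(\<Sum>i\<in>UNIV. lor_sign i * (\<nu> $ i)\<^sup>2) = 1"
    using assms lor_quad_lower[of \<nu>]
        by (simp add: lor_quad_def lower_def power_mult_distrib power2_eq_square[of "lor_sign _"])
  have 2: "(\<Sum>i\<in>UNIV. \<nu> $ i * y $ i) = y \<bullet> \<nu>"
    by (simp add: inner_vec_def mult.commute)
  have 3: "(\<Sum>i\<in>UNIV. lor_sign i * (y $ i)\<^sup>2) = lor_quad y" by (simp add: lor_quad_def)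
  have "lor_sign i * zonal_monom_dd \<nu> i a b y =
      (lor_sign i * (\<nu> $ i)\<^sup>2) * (real a * real (a - 1) * zonal_monom \<nu> (a - 1 - 1) b y)
    + (\<nu> $ i * y $ i) * (4 * real a * real b * zonal_monom \<nu> (a - 1) (b - 1) y)
    + 2 * real b * zonal_monom \<nu> a (b - 1) y
    + (lor_sign i * (y $ i)\<^sup>2) * (4 * real b * real (b - 1) * zonal_monom \<nu> a (b - 1 - 1) y)" for i
    unfolding zonal_monom_dd_def zonal_monom_d_def
    by (simp add: algebra_simps power2_eq_square)
  then have "(\<Sum>i\<in>UNIV. lor_sign i * zonal_monom_dd \<nu> i a b y) =
      real a * real (a - 1) * zonal_monom \<nu> (a - 1 - 1) b y
    + 4 * real b * (real a * ((y \<bullet> \<nu>) * zonal_monom \<nu> (a - 1) (b - 1) y))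
    + real CARD('n option) * (2 * real b * zonal_monom \<nu> a (b - 1) y)
    + 4 * real b * (real (b - 1) * (lor_quad y * zonal_monom \<nu> a (b - 1 - 1) y))"
    by (simp add: sum.distrib sum_distrib_right[symmetric] 1 2 3)
  \<comment> \<open>The exponents are truncated differences, so \<open>a = 0\<close>,
    \<open>b = 0\<close> and \<open>b = 1\<close> are treated apart; there the factor in front
    vanishes.\<close>
  also have "real a * real (a - 1) = real a * (real a - 1)" by (cases a) auto
  also have "real a * ((y \<bullet> \<nu>) * zonal_monom \<nu> (a - 1) (b - 1) y)
      = real a * zonal_monom \<nu> a (b - 1) y"
    by (cases a) (auto simp: zonal_monom_def)
  also have "4 * real b * (real (b - 1) * (lor_quad y * zonal_monom \<nu> a (b - 1 - 1) y))
      = 4 * real b * ((real b - 1) * zonal_monom \<nu> a (b - 1) y)"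
  proof (cases b)
    case (Suc c) then show ?thesis by (cases c) (auto simp: zonal_monom_def)
  qed auto
  also have "a - 1 - 1 = a - 2" by simp
  finally show ?thesis by (simp add: algebra_simps)
qed

lemma zonal_eq_sum: "zonal k \<nu> y = (\<Sum>j\<le>k div 2. gegenbauer_coeff CARD('n option) k j
    * zonal_monom \<nu> (k - 2 * j) j y)"
  for \<nu> y :: "('n::finite) vec1"
  by (simp add: zonal_def zonal_monom_def)

lemma laplacian_zonal:
  fixes \<nu> y :: "('n::finite) vec1"
  assumes "lor \<nu> \<nu> = 1"
  shows "(\<Sum>i\<in>UNIV. lor_sign i * (\<Sum>j\<le>k div 2. gegenbauer_coeff CARD('n option) k j
      * zonal_monom_dd \<nu> i (k - 2 * j) j y)) = 0"
proof -
  define d where "d = CARD('n option)"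
  have d: "d > 0" unfolding d_def by simp
  \<comment> \<open>\<open>s j\<close> is the part of the Laplacian of the \<open>j\<close>th term
    that lowers the power of \<open>y \<bullet> \<nu>\<close>, and \<open>r j\<close> the part that
    lowers the power of \<open>lor_quad\<close>. The recursion makes \<open>r (Suc j)\<close> cancel
    \<open>s j\<close>.\<close>
  define s where "s j = gegenbauer_coeff d k j * ((real k - 2 * real j) * (real k - 2 * real j
      - 1)) * zonal_monom \<nu> (k - 2 * j - 2) j y" for j
  define r where "r j = gegenbauer_coeff d k j * (real j * (4 * (real k - 2 * real j) + 2 * real d
      + 4 * (real j - 1)))
      * zonal_monom \<nu> (k - 2 * j) (j - 1) y" for j
  have "(\<Sum>i\<in>UNIV. lor_sign i * (\<Sum>j\<le>k div 2. gegenbauer_coeff d k j * zonal_monom_dd \<nu> i (k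
      - 2 * j) j y))
     = (\<Sum>j\<le>k div 2. gegenbauer_coeff d k j * (\<Sum>i\<in>UNIV. lor_sign i * zonal_monom_dd \<nu> i (k - 2 * j) j y))"
    unfolding sum_distrib_left by (subst sum.swap) (simp add: mult_ac)
  also have "\<dots> = (\<Sum>j\<le>k div 2. s j + r j)"
    unfolding laplacian_zonal_monom[OF assms] s_def r_def
    by (intro sum.cong) (auto simp: of_nat_diff distrib_left mult_ac d_def)
  also have "\<dots> = (\<Sum>j\<le>k div 2. s j) + (\<Sum>j\<le>k div 2. r j)" by (rule sum.distrib)
  also have "(\<Sum>j\<le>k div 2. s j) = (\<Sum>j<k div 2. s j)"
  proof -
    \<comment> \<open>The last \<open>s\<close> has no partner; one of its two numerical factors
      vanishes, according to the parity of \<open>k\<close>.\<close>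
    have "k = 2 * (k div 2) \<or> k = 2 * (k div 2) + 1" by presburger
    then have "real k - 2 * real (k div 2) = 0 \<or> real k - 2 * real (k div 2) - 1 = 0"
      by linarith
    then have "s (k div 2) = 0" unfolding s_def by auto
    then show ?thesis by (simp add: lessThan_Suc_atMost[symmetric])
  qed
  also have "(\<Sum>j\<le>k div 2. r j) = (\<Sum>j<k div 2. r (Suc j))"
    unfolding lessThan_Suc_atMost[symmetric] sum.lessThan_Suc_shift by (simp add: r_def)
  also have "r (Suc j) = - s j" if "j < k div 2" for j
  proof -
    \<comment> \<open>The denominator of the recursion is nonzero: this inequality makes its second
      factor at least \<open>d\<close>.\<close>
    have "2 * real j + 2 \<le> real k" using that by linarith
    then have "2 * real k - 2 * real j - 4 + real d > 0" using d by (simp add: algebra_simps)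
    moreover have "real (Suc j) * (4 * (real k - 2 * real (Suc j)) + 2 * real d
        + 4 * (real (Suc j) - 1))
      = 2 * (real j + 1) * (2 * real k - 2 * real j - 4 + real d)"
      by (simp add: algebra_simps)
    ultimately have "gegenbauer_coeff d k (Suc j) * (real (Suc j) * (4 * (real k - 2 * real (Suc j))
        + 2 * real d + 4 * (real (Suc j) - 1)))
      = - (gegenbauer_coeff d k j * ((real k - 2 * real j) * (real k - 2 * real j - 1)))"
      by simp
    moreover have "k - 2 * Suc j = k - 2 * j - 2" by simp
    ultimately show ?thesis unfolding r_def s_def by simp
  qed
  then have "(\<Sum>j<k div 2. r (Suc j)) = - (\<Sum>j<k div 2. s j)"
    by (simp add: sum_negf[symmetric])
  finally show ?thesis by (simp add: d_def)
qed

text \<open>Unique by \<open>tensor_form_inject\<close>, so nothing depends on the choice.\<close>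

definition zonal_tensor :: "nat \<Rightarrow> ('n::finite) vec1 \<Rightarrow> 'n tensor" where
  "zonal_tensor k \<nu> = (SOME T. depends_below k T \<and> symmetric_tensor k T \<and> tensor_form k T
      = zonal k \<nu>)"

lemma zonal_tensor: "depends_below k (zonal_tensor k \<nu>)" "symmetric_tensor k (zonal_tensor k \<nu>)"
  "tensor_form k (zonal_tensor k \<nu>) = zonal k \<nu>"
proof -
  obtain T where "depends_below k T" "zonal k \<nu> = tensor_form k T" using is_form_zonal
      unfolding is_form_def by blast
  then have "depends_below k (symmetrize k T) \<and> symmetric_tensor k (symmetrize k T)
      \<and> tensor_form k (symmetrize k T) = zonal k \<nu>"
    by (simp add: depends_below_symmetrize symmetric_tensor_symmetrize tensor_form_symmetrize fun_eq_iff)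
  then have "depends_below k (zonal_tensor k \<nu>) \<and> symmetric_tensor k (zonal_tensor k \<nu>)
      \<and> tensor_form k (zonal_tensor k \<nu>) = zonal k \<nu>"
    unfolding zonal_tensor_def
    by (rule someI[of "\<lambda>T. depends_below k T \<and> symmetric_tensor k T \<and> tensor_form k T = zonal k \<nu>"])
  then show "depends_below k (zonal_tensor k \<nu>)" "symmetric_tensor k (zonal_tensor k \<nu>)"
    "tensor_form k (zonal_tensor k \<nu>) = zonal k \<nu>" by auto
qed

lemma sym_trfree_iff: "T \<in> sym_trfree k \<longleftrightarrow> depends_below k T \<and> symmetric_tensor k T \<and>
   (k \<ge> 2 \<longrightarrow> (\<forall>f. (\<Sum>i\<in>UNIV. lor_sign i * T (f(0 := i, 1 := i))) = 0))"
  unfolding sym_trfree_def depends_below_def symmetric_tensor_def lor_sign_def by simp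

lemma zonal_tensor_sym_trfree:
  fixes \<nu> :: "('n::finite) vec1"
  assumes "lor \<nu> \<nu> = 1"
  shows "zonal_tensor k \<nu> \<in> sym_trfree k"
proof -
  have "(\<Sum>i\<in>UNIV. lor_sign i * zonal_tensor k \<nu> (f(0 := i, 1 := i))) = 0" if "k \<ge> 2" for f
  proof -
    define k' where "k' = k - 2"
    have k: "k = Suc (Suc k')" using that by (simp add: k'_def)
    let ?P1 = "\<lambda>i y. \<Sum>j\<le>k div 2. gegenbauer_coeff CARD('n option) k j * zonal_monom_d \<nu> i (k
        - 2 * j) j y"
    let ?P2 = "\<lambda>i y. \<Sum>j\<le>k div 2. gegenbauer_coeff CARD('n option) k j * zonal_monom_dd \<nu> i (k
        - 2 * j) j y"
    show ?thesis
    proof (rule trace_free_if_laplacian_0[where k = k' and T =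
        "zonal_tensor k \<nu>" and ?P1.0 = ?P1 and ?P2.0 = ?P2])
      show "depends_below (Suc (Suc k')) (zonal_tensor k \<nu>)"
          "symmetric_tensor (Suc (Suc k')) (zonal_tensor k \<nu>)"
        using zonal_tensor(1,2) k by metis+
      show "((\<lambda>t. tensor_form (Suc (Suc k')) (zonal_tensor k \<nu>) (y + t *\<^sub>R axis i 1))
          has_real_derivative
          ?P1 i (y + t *\<^sub>R axis i 1)) (at t)" for i y t
        unfolding k[symmetric] zonal_tensor(3) zonal_eq_sum
        by (intro DERIV_sum DERIV_cmult zonal_monom_has_derivative)
      show "((\<lambda>t. ?P1 i (y + t *\<^sub>R axis i 1))
          has_real_derivative ?P2 i (y + t *\<^sub>R axis i 1)) (at t)" for i y t
        by (intro DERIV_sum DERIV_cmult zonal_monom_d_has_derivative)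
      show "(\<Sum>i\<in>UNIV. lor_sign i * ?P2 i y) = 0" for y by (rule laplacian_zonal[OF assms])
    qed
  qed
  then show ?thesis unfolding sym_trfree_iff using zonal_tensor(1,2) by blast
qed

lemma sym_trfree_scale: "T \<in> sym_trfree k \<Longrightarrow> (\<lambda>f. c * T f) \<in> sym_trfree k"
  unfolding sym_trfree_iff depends_below_def symmetric_tensor_def
  by (auto simp: sum_distrib_left[symmetric] mult.left_commute[of "lor_sign _" c])

lemma sym_trfree_sum:
  assumes "\<And>a. a \<in> I \<Longrightarrow> T a \<in> sym_trfree k"
  shows "(\<lambda>f. \<Sum>a\<in>I. T a f) \<in> sym_trfree k"
proof -
  have "(\<Sum>i\<in>UNIV. lor_sign i * (\<Sum>a\<in>I. T a (f(0 := i, 1 := i)))) = 0" if "k \<ge> 2" for f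
    unfolding sum_distrib_left using assms that
    by (subst sum.swap) (auto simp: sym_trfree_iff)
  moreover have "depends_below k (\<lambda>f. \<Sum>a\<in>I. T a f)" "symmetric_tensor k (\<lambda>f. \<Sum>a\<in>I. T a f)"
    using assms unfolding sym_trfree_iff depends_below_def symmetric_tensor_def
        by (auto intro!: sum.cong)
  ultimately show ?thesis unfolding sym_trfree_iff by blast
qed

section \<open>The action of matrices, and evaluation on vectors\<close>

lemma tensor_form_tensor_act: "tensor_form k (tensor_act k A T) y = tensor_form k T (y v* A)"
proof -
  have "tensor_form k (tensor_act k A T) y = (\<Sum>g\<in>PiE {..<k} (\<lambda>_. UNIV). \<Sum>f\<in>PiE {..<k} (\<lambda>_. UNIV).
      (\<Prod>m<k. y $ f m * A $ f m $ g m) * T g)"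
    unfolding tensor_form_def tensor_act_def sum_distrib_left
    by (subst sum.swap) (simp add: prod.distrib mult.assoc)
  also have "\<dots> = (\<Sum>g\<in>PiE {..<k} (\<lambda>_. UNIV). (\<Prod>m<k. \<Sum>i\<in>UNIV. y $ i * A $ i $ g m) * T g)"
    by (subst prod_sum_PiE) (simp_all add: sum_distrib_right)
  also have "\<dots> = tensor_form k T (y v* A)"
    by (simp add: tensor_form_def vector_matrix_mult_def mult.commute)
  finally show ?thesis .
qed

lemma depends_below_tensor_act: "depends_below k (tensor_act k A T)"
  unfolding depends_below_def tensor_act_def by (auto intro!: sum.cong)

lemma symmetric_tensor_tensor_act:
  assumes "symmetric_tensor k T" shows "symmetric_tensor k (tensor_act k A T)"
  unfolding symmetric_tensor_def
proof (intro allI impI)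
  fix \<sigma> and f :: "nat \<Rightarrow> 'a option" assume s: "\<sigma> permutes {..<k}"
  have "tensor_act k A T (f \<circ> \<sigma>)
      = (\<Sum>g\<in>PiE {..<k} (\<lambda>_. UNIV). (\<Prod>m<k. A $ (f \<circ> \<sigma>) m $ (g \<circ> \<sigma>) m) * T (g \<circ> \<sigma>))"
    unfolding tensor_act_def by (rule sum_PiE_permute[OF s, symmetric])
  also have "\<dots> = tensor_act k A T f"
    using prod.permute[OF s, of "\<lambda>m. A $ f m $ _ m"] assms s
    by (simp add: tensor_act_def symmetric_tensor_def o_def)
  finally show "tensor_act k A T (f \<circ> \<sigma>) = tensor_act k A T f" .
qed

lemma lower_mult_lorentz:
  assumes "\<And>x y. lor (A *v x) (A *v y) = lor x y"
  shows "lower (A *v x) v* A = lower x"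
proof -
  have "(lower (A *v x) v* A) \<bullet> w = lower x \<bullet> w" for w
    using assms[of x w] by (simp add: lor_lower dot_lmul_matrix)
  then show ?thesis by (metis vector_eq_rdot)
qed

text \<open>Contracts every slot with \<open>x\<close> through \<open>lor\<close>. In this form the
  action of a Lorentz map \<open>A\<close> satisfies \<open>(A T) (A x) = T x\<close>.\<close>

definition tensor_eval :: "nat \<Rightarrow> ('n::finite) tensor \<Rightarrow> 'n vec1 \<Rightarrow> real" where
  "tensor_eval k T x = tensor_form k T (lower x)"

lemma tensor_eval_tensor_act:
  assumes "\<And>x y. lor (A *v x) (A *v y) = lor x y"
  shows "tensor_eval k (tensor_act k A T) (A *v x) = tensor_eval k T x"
  unfolding tensor_eval_def tensor_form_tensor_act lower_mult_lorentz[OF assms] ..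

lemma tensor_eval_zonal_tensor:
  "tensor_eval k (zonal_tensor k \<nu>) x
     = (\<Sum>j\<le>k div 2. gegenbauer_coeff CARD('n option) k j * (lor x \<nu> ^ (k - 2 * j) * lor x x ^ j))"
  for x \<nu> :: "('n::finite) vec1"
  by (simp add: tensor_eval_def zonal_tensor zonal_def lor_quad_lower lor_lower)

text \<open>Both sides have the same value at \<open>A *v x\<close>, since the zonal polynomial sees
  only \<open>lor x \<nu>\<close> and \<open>lor x x\<close>. Surjectivity reaches every point, and
  symmetric tensors are determined by their polynomials.\<close>

lemma tensor_act_zonal_tensor:
  assumes A: "\<And>x y. lor (A *v x) (A *v y) = lor x y" and "surj ((*v) A)"
  shows "tensor_act k A (zonal_tensor k \<nu>) = zonal_tensor k (A *v \<nu>)"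
proof (rule tensor_form_inject[of k])
  fix y
  obtain x where x: "lower y = A *v x" using assms(2) by (metis surjD)
  have "tensor_eval k (tensor_act k A (zonal_tensor k \<nu>)) (A *v x)
      = tensor_eval k (zonal_tensor k (A *v \<nu>)) (A *v x)"
    unfolding tensor_eval_tensor_act[OF A] tensor_eval_zonal_tensor A ..
  then show "tensor_form k (tensor_act k A (zonal_tensor k \<nu>)) y
      = tensor_form k (zonal_tensor k (A *v \<nu>)) y"
    by (simp add: tensor_eval_def x[symmetric])
qed (auto simp: depends_below_tensor_act symmetric_tensor_tensor_act zonal_tensor)

lemma tensor_eval_add: "tensor_eval k (\<lambda>f. T f + U f) x = tensor_eval k T x + tensor_eval k U x"
  by (simp add: tensor_eval_def tensor_form_add)

lemma tensor_eval_scale: "tensor_eval k (\<lambda>f. c * T f) x = c * tensor_eval k T x"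
  by (simp add: tensor_eval_def tensor_form_scale)

lemma tensor_eval_sum: "tensor_eval k (\<lambda>f. \<Sum>i\<in>I. T i f) x = (\<Sum>i\<in>I. tensor_eval k (T i) x)"
  by (simp add: tensor_eval_def tensor_form_sum)

lemma lower_add: "lower (x + y) = lower x + lower y" and lower_scaleR: "lower (c *\<^sub>R x)
    = c *\<^sub>R lower x"
  by (simp_all add: lower_def vec_eq_iff algebra_simps)

lemma tensor_eval_homogeneous: "tensor_eval k T (c *\<^sub>R x) = c ^ k * tensor_eval k T x"
  by (simp add: tensor_eval_def lower_scaleR tensor_form_homogeneous)

lemma tensor_eval_curve_poly: "\<exists>p. \<forall>u. tensor_eval k T (a + u *\<^sub>R b + u\<^sup>2 *\<^sub>R c) = poly p u"
  unfolding tensor_eval_def lower_add lower_scaleR by (rule tensor_form_curve_poly)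

lemma continuous_tensor_eval: "continuous_on X (tensor_eval k T)"
proof -
  have "continuous_on X lower" unfolding lower_def by (intro continuous_intros)
  then show ?thesis unfolding tensor_eval_def
    by (rule continuous_on_compose2[OF continuous_tensor_form[of UNIV]]) simp
qed

subsection \<open>Hyperbolic geometry\<close>

lemma lor_inner: "lor x y = x \<bullet> y - 2 * (x $ None * y $ None)"
proof -
  have "(if i = None then - 1 else 1) * (x $ i * y $ i)
      = x $ i * y $ i - (if i = None then 2 * (x $ None * y $ None) else 0)" for i
    by simp
  then show ?thesis by (simp add: lor_def inner_vec_def sum_subtractf)
qed

lemma lor_commute: "lor x y = lor y x"
  by (simp add: lor_inner inner_commute)

lemma lor_add_left: "lor (x + y) z = lor x z + lor y z"
  and lor_add_right: "lor z (x + y) = lor z x + lor z y"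
  and lor_diff_left: "lor (x - y) z = lor x z - lor y z"
  and lor_diff_right: "lor z (x - y) = lor z x - lor z y"
  and lor_scaleR_left: "lor (c *\<^sub>R x) z = c * lor x z"
  and lor_scaleR_right: "lor z (c *\<^sub>R x) = c * lor z x"
  and lor_minus_left: "lor (- x) z = - lor x z"
  and lor_minus_right: "lor z (- x) = - lor z x"
  by (simp_all add: lor_inner algebra_simps inner_simps)

lemmas lor_simps = lor_add_left lor_add_right lor_diff_left lor_diff_right
  lor_scaleR_left lor_scaleR_right lor_minus_left lor_minus_right

lemma continuous_lor [continuous_intros]:
  "continuous_on X f \<Longrightarrow> continuous_on X g \<Longrightarrow> continuous_on X (\<lambda>x. lor (f x) (g x))"
  unfolding lor_inner by (intro continuous_intros)

lemma lor_self_time_zero: "x $ None = 0 \<Longrightarrow> lor x x = (norm x)\<^sup>2"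
  by (simp add: lor_inner power2_norm_eq_inner)

lemma hyp_spaceD:
  assumes "x \<in> hyp_space" shows "lor x x = - 1" "x $ None > 0"
  using assms by (auto simp: hyp_space_def)

lemma lor_neg:
  assumes "x \<in> hyp_space" "y \<in> hyp_space" shows "lor x y < 0"
proof -
  note x = hyp_spaceD[OF assms(1)] and y = hyp_spaceD[OF assms(2)]
  \<comment> \<open>This combination has time coordinate 0, so \<open>lor ?z ?z\<close> is
    nonnegative; expanding it bounds \<open>lor x y\<close> from above.\<close>
  let ?z = "y $ None *\<^sub>R x - x $ None *\<^sub>R y"
  have "0 \<le> lor ?z ?z" by (subst lor_self_time_zero) auto
  also have "lor ?z ?z = - (y $ None)\<^sup>2 - (x $ None)\<^sup>2 - 2 * (x $ None * y $ None) * lor x y"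
    using x y by (simp add: lor_simps lor_commute[of y x] power2_eq_square algebra_simps)
  finally have "(2 * (x $ None * y $ None)) * lor x y \<le> - ((y $ None)\<^sup>2 + (x $ None)\<^sup>2)" by simp
  also have "\<dots> < 0" using zero_less_power[OF x(2), of 2] zero_less_power[OF y(2), of 2] by linarith
  finally show ?thesis using x y by (simp add: mult_less_0_iff)
qed

lemma hyp_spaceI:
  assumes "lor x x = - 1" "y \<in> hyp_space" "lor x y < 0" shows "x \<in> hyp_space"
proof -
  have "x $ None \<noteq> 0" using lor_self_time_zero[of x] assms(1)
      by (metis neg_0_le_iff_le not_one_le_zero zero_le_power2)
  moreover have "\<not> x $ None < 0"
  proof
    assume "x $ None < 0"
    then have "- x \<in> hyp_space" using assms(1) by (simp add: hyp_space_def lor_simps)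
    from lor_neg[OF this assms(2)] assms(3) show False by (simp add: lor_simps)
  qed
  ultimately show ?thesis using assms(1) by (simp add: hyp_space_def)
qed

lemma spacelike_if_orthogonal:
  assumes "x \<in> hyp_space" "lor b x = 0" "b \<noteq> 0" shows "lor b b > 0"
proof -
  note x = hyp_spaceD[OF assms(1)]
  \<comment> \<open>Subtracting this multiple of \<open>x\<close> kills the time coordinate, and
    orthogonality gives \<open>lor b b = (norm z)\<^sup>2 + c\<^sup>2\<close>.\<close>
  define c where "c = b $ None / x $ None"
  define z where "z = b - c *\<^sub>R x"
  have z0: "z $ None = 0" using x by (simp add: z_def c_def)
  have "lor z z = lor b b - c\<^sup>2"
    unfolding z_def using x assms(2) by (simp add: lor_simps lor_commute[of x b] power2_eq_square)
  then have "lor b b = (norm z)\<^sup>2 + c\<^sup>2" using lor_self_time_zero[OF z0] by simp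
  moreover have "z \<noteq> 0 \<or> c \<noteq> 0" using assms(3) by (auto simp: z_def)
  ultimately show ?thesis by (auto simp: add_pos_nonneg add_nonneg_pos)
qed

text \<open>Two linear conditions leave a nonzero vector because the dimension is at least 3; being
  orthogonal to \<open>x\<close> it is spacelike and can be normalized.\<close>

lemma exists_unit_orthogonal:
  fixes x \<mu> :: "('n::finite) vec1"
  assumes "CARD('n) \<ge> 2" "x \<in> hyp_space"
  obtains b where "lor b b = 1" "lor b x = 0" "lor b \<mu> = 0"
proof -
  have "dim (span {lower x, lower \<mu>}) \<le> card {lower x, lower \<mu>}"
    by (simp add: dim_le_card')
  also have "\<dots> \<le> 2" by (simp add: card_insert_if)
  also have "2 < DIM('n vec1)" using assms(1) by simp
  finally obtain b where b: "b \<noteq> 0" "\<And>y. y \<in> span {lower x, lower \<mu>} \<Longrightarrow> orthogonal b y"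
    using orthogonal_to_subspace_exists[of "{lower x, lower \<mu>}"] by (metis dim_span)
  have "orthogonal b (lower x)" "orthogonal b (lower \<mu>)" by (auto intro!: b(2) span_base)
  then have o: "lor b x = 0" "lor b \<mu> = 0"
    by (metis lor_commute lor_lower inner_commute orthogonal_def)+
  have p: "lor b b > 0" by (rule spacelike_if_orthogonal[OF assms(2) o(1) b(1)])
  show ?thesis
  proof (rule that[of "(1 / sqrt (lor b b)) *\<^sub>R b"])
    show "lor ((1 / sqrt (lor b b)) *\<^sub>R b) ((1 / sqrt (lor b b)) *\<^sub>R b) = 1"
      using p by (simp add: lor_simps)
  qed (simp_all add: lor_simps o)
qed

section \<open>Radial projection to the hyperboloid, and chords\<close>

definition hyp_normalize :: "('n::finite) vec1 \<Rightarrow> 'n vec1" where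
  "hyp_normalize x = (1 / sqrt (- lor x x)) *\<^sub>R x"

lemma hyp_normalize_hyp_space: "lor x x < 0 \<Longrightarrow> x $ None > 0 \<Longrightarrow> hyp_normalize x \<in> hyp_space"
  by (simp add: hyp_normalize_def hyp_space_def lor_simps field_simps)

lemma lor_hyp_normalize_left: "lor (hyp_normalize x) \<nu> = lor x \<nu> / sqrt (- lor x x)"
  by (simp add: hyp_normalize_def lor_simps)

lemma lor_hyp_normalize_eq_0_iff: "lor x x < 0 \<Longrightarrow> lor (hyp_normalize x) \<nu> = 0 \<longleftrightarrow> lor x \<nu> = 0"
  by (simp add: lor_hyp_normalize_left)

lemma hyperplane_nonempty:
  fixes \<nu> :: "('n::finite) vec1"
  assumes "lor \<nu> \<nu> = 1"
  obtains x where "x \<in> hyperplane_H \<nu>"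
proof -
  define e :: "'n vec1" where "e = axis None 1"
  have e: "lor e y = - y $ None" for y
    by (simp add: lor_inner e_def inner_axis')
  define y where "y = e + \<nu> $ None *\<^sub>R \<nu>"
  have "lor y \<nu> = 0" by (simp add: y_def lor_simps assms e)
  moreover have "y $ None > 0" by (simp add: y_def e_def add_pos_nonneg)
  moreover have "lor y y < 0"
  proof -
    have "lor y y = - 1 - (\<nu> $ None)\<^sup>2"
      by (simp add: y_def lor_simps assms e lor_commute[of \<nu> e] power2_eq_square) (simp add: e_def)
    then show ?thesis using zero_le_power2[of "\<nu> $ None"] by linarith
  qed
  ultimately have "hyp_normalize y \<in> hyperplane_H \<nu>"
    by (simp add: hyperplane_H_def hyp_normalize_hyp_space lor_hyp_normalize_eq_0_iff)
  then show ?thesis by (rule that)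
qed

text \<open>The chord in the ambient space, whose radial projection is the geodesic from
  \<open>x\<close> to \<open>y\<close>. Walls are cut out by linear equations, so crossings can be
  read off from the chord, on which \<open>lor\<close> is affine in \<open>t\<close>.\<close>

definition segment :: "('n::finite) vec1 \<Rightarrow> 'n vec1 \<Rightarrow> real \<Rightarrow> 'n vec1" where
  "segment x y t = (1 - t) *\<^sub>R x + t *\<^sub>R y"

lemma lor_segment: "lor (segment x y t) \<nu> = (1 - t) * lor x \<nu> + t * lor y \<nu>"
  by (simp add: segment_def lor_simps)

lemma segment_timelike:
  assumes "x \<in> hyp_space" "y \<in> hyp_space" "0 \<le> t" "t \<le> 1"
  shows "lor (segment x y t) (segment x y t) < 0" "segment x y t $ None > 0"
proof -
  note x = hyp_spaceD[OF assms(1)] and y = hyp_spaceD[OF assms(2)]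
  have "lor (segment x y t) (segment x y t) = - (1 - t)\<^sup>2 - t\<^sup>2 + 2 * (t * (1 - t) * lor x y)"
    using x y by (simp add: segment_def lor_simps lor_commute[of y x] power2_eq_square algebra_simps)
  moreover have "t * (1 - t) * lor x y \<le> 0"
    using lor_neg[OF assms(1,2)] assms(3,4) by (simp add: mult_nonneg_nonpos)
  moreover have "(1 - t)\<^sup>2 + t\<^sup>2 > 0" by (simp add: sum_power2_gt_zero_iff)
  ultimately show "lor (segment x y t) (segment x y t) < 0" by linarith
  show "segment x y t $ None > 0"
  proof (cases "t = 0")
    case False
    then have "t * y $ None > 0" using assms(3) y by simp
    moreover have "(1 - t) * x $ None \<ge> 0" using assms(4) x by simp
    ultimately show ?thesis by (simp add: segment_def)
  qed (use x in \<open>simp add: segment_def\<close>)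
qed

lemma hyp_normalize_segment_hyp_space:
  "x \<in> hyp_space \<Longrightarrow> y \<in> hyp_space \<Longrightarrow> 0 \<le> t \<Longrightarrow> t \<le> 1 \<Longrightarrow> hyp_normalize (segment x y t) \<in> hyp_space"
  by (intro hyp_normalize_hyp_space segment_timelike)

lemma hyp_normalize_segment_in_hyperplane:
  "x \<in> hyp_space \<Longrightarrow> y \<in> hyp_space \<Longrightarrow> 0 \<le> t \<Longrightarrow> t \<le> 1 \<Longrightarrow>
    hyp_normalize (segment x y t) \<in> hyperplane_H \<nu> \<longleftrightarrow> lor (segment x y t) \<nu> = 0"
  by (simp add: hyperplane_H_def hyp_normalize_segment_hyp_space lor_hyp_normalize_eq_0_iff segment_timelike)

lemma linear_sign_change:
  fixes a b :: real
  assumes "(a > 0) \<noteq> (b > 0)"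
  obtains t where "0 \<le> t" "t \<le> 1" "(1 - t) * a + t * b = 0"
proof (rule that[of "a / (a - b)"])
  have "a - b \<noteq> 0" using assms by auto
  then show "(1 - a / (a - b)) * a + a / (a - b) * b = 0"
    by (simp add: add_divide_distrib[symmetric] diff_divide_distrib[symmetric] divide_simps)
  show "0 \<le> a / (a - b)" "a / (a - b) \<le> 1"
    using assms by (auto simp: divide_simps)
qed

text \<open>Serves to bound the walls crossed between points of \<open>K\<close>: such a wall meets
  the geodesic joining them, hence meets the compact set \<open>L\<close>.\<close>

lemma compact_join:
  assumes "compact K" "K \<subseteq> hyp_space"
  obtains L where "compact L" "L \<subseteq> hyp_space" "K \<subseteq> L"
    "\<And>x y t. x \<in> K \<Longrightarrow> y \<in> K \<Longrightarrow> 0 \<le> t \<Longrightarrow> t \<le> 1 \<Longrightarrow> hyp_normalize (segment x y t) \<in> L"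
proof -
  define f where "f = (\<lambda>(t, x, y). hyp_normalize (segment x y t) :: 'a vec1)"
  define L where "L = f ` ({0..1} \<times> K \<times> K)"
  have "continuous_on ({0..1} \<times> K \<times> K) f"
    unfolding f_def hyp_normalize_def segment_def case_prod_beta
    using segment_timelike(1) assms(2)
    by (intro continuous_intros) (force simp: segment_def[symmetric] less_le)
  then have "compact L"
    unfolding L_def using assms(1) by (intro compact_continuous_image compact_Times) auto
  moreover have "L \<subseteq> hyp_space"
    using assms(2) hyp_normalize_segment_hyp_space by (force simp: L_def f_def)
  moreover have in_L: "hyp_normalize (segment x y t) \<in> L" if "x \<in> K" "y \<in> K" "0 \<le> t" "t
      \<le> 1" for x y t
    unfolding L_def using that by (intro image_eqI[of _ _ "(t, x, y)"]) (auto simp: f_def)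
  moreover have "K \<subseteq> L"
  proof
    fix x assume "x \<in> K"
    then have "hyp_normalize (segment x x 0) = x" using assms(2) hyp_spaceD(1)[of x]
        by (auto simp: segment_def hyp_normalize_def)
    then show "x \<in> L" using in_L[OF \<open>x \<in> K\<close> \<open>x \<in> K\<close>, of 0] by simp
  qed
  ultimately show ?thesis using that by blast
qed

text \<open>The geodesic with initial point \<open>a\<close> and unit tangent vector \<open>b\<close>, parametrized by
  \<open>u = e\<^sup>t\<close>; forms restrict to Laurent polynomials in \<open>u\<close>.\<close>

definition geodesic :: "('n::finite) vec1 \<Rightarrow> 'n vec1 \<Rightarrow> real \<Rightarrow> 'n vec1" where
  "geodesic a b u = ((u + 1 / u) / 2) *\<^sub>R a + ((u - 1 / u) / 2) *\<^sub>R b"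

lemma geodesic_1 [simp]: "geodesic a b 1 = a"
  by (simp add: geodesic_def)

lemma lor_geodesic: "lor (geodesic a b u) \<nu>
    = ((u + 1 / u) / 2) * lor a \<nu> + ((u - 1 / u) / 2) * lor b \<nu>"
  by (simp add: geodesic_def lor_simps)

lemma geodesic_hyp_space:
  assumes "a \<in> hyp_space" "lor b b = 1" "lor b a = 0" "u > 0"
  shows "geodesic a b u \<in> hyp_space"
proof (rule hyp_spaceI[OF _ assms(1)])
  note a = hyp_spaceD[OF assms(1)]
  have "lor (p *\<^sub>R a + q *\<^sub>R b) (p *\<^sub>R a + q *\<^sub>R b) = q\<^sup>2 - p\<^sup>2" for p q
    using a assms(2,3) by (simp add: lor_simps lor_commute[of a b] power2_eq_square)
  then have "lor (geodesic a b u) (geodesic a b u) = ((u - 1 / u) / 2)\<^sup>2 - ((u + 1 / u) / 2)\<^sup>2"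
    unfolding geodesic_def .
  also have "\<dots> = - 1" using assms(4) by (simp add: power2_eq_square field_simps)
  finally show "lor (geodesic a b u) (geodesic a b u) = - 1" .
  show "lor (geodesic a b u) a < 0" using a assms(3,4) by (simp add: lor_geodesic add_pos_pos)
qed

text \<open>\<open>v\<close> is \<open>exp (arsinh s)\<close>, the geodesic parameter at which the
  coefficient of the tangent vector is \<open>s\<close>.\<close>

lemma exp_param:
  fixes s :: real
  defines "v \<equiv> s + sqrt (1 + s\<^sup>2)"
  shows "v > 0" "(v - 1 / v) / 2 = s" "(v + 1 / v) / 2 = sqrt (1 + s\<^sup>2)"
proof -
  have "\<bar>s\<bar> < sqrt (1 + s\<^sup>2)" by (rule real_less_rsqrt) simp
  then show v: "v > 0" by (simp add: v_def)
  have "v * (sqrt (1 + s\<^sup>2) - s) = 1" by (simp add: v_def algebra_simps power2_eq_square[symmetric])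
  then have "1 / v = sqrt (1 + s\<^sup>2) - s" using v by (simp add: field_simps)
  then show "(v - 1 / v) / 2 = s" "(v + 1 / v) / 2 = sqrt (1 + s\<^sup>2)" by (simp_all add: v_def)
qed

text \<open>Write \<open>y = c *\<^sub>R a + z\<close> with \<open>z\<close> orthogonal to
  \<open>a\<close>. Then \<open>c\<close> and \<open>s\<close> are cosh and sinh of the distance,
  \<open>b\<close> is \<open>z\<close> normalized, and \<open>u = s + c\<close>. As a combination of
  \<open>a\<close> and \<open>y\<close>, \<open>b\<close> is orthogonal to whatever both
  are.\<close>

lemma geodesic_join:
  assumes "a \<in> hyp_space" "y \<in> hyp_space" "a \<noteq> y"
  obtains b u where "lor b b = 1" "lor b a = 0" "u > 0" "y = geodesic a b u"
    "\<And>\<nu>. lor a \<nu> = 0 \<Longrightarrow> lor y \<nu> = 0 \<Longrightarrow> lor b \<nu> = 0"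
proof -
  note a = hyp_spaceD[OF assms(1)] and y = hyp_spaceD[OF assms(2)]
  define c where "c = - lor a y"
  define z where "z = y - c *\<^sub>R a"
  have c: "c > 0" using lor_neg[OF assms(1,2)] by (simp add: c_def)
  have za: "lor z a = 0" using a by (simp add: z_def lor_simps c_def lor_commute[of y a])
  have zz: "lor z z = c\<^sup>2 - 1"
    using a y by (simp add: z_def lor_simps c_def lor_commute[of y a] power2_eq_square)
  have "z \<noteq> 0"
  proof
    assume z: "z = 0"
    then have "c\<^sup>2 = 1" using zz by (simp add: lor_inner)
    then have "c = 1" using c by (simp add: power2_eq_1_iff)
    with z assms(3) show False by (simp add: z_def)
  qed
  then have p: "lor z z > 0" by (intro spacelike_if_orthogonal[OF assms(1) za])
  define s where "s = sqrt (lor z z)"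
  have s: "s > 0" "s\<^sup>2 = lor z z" using p by (simp_all add: s_def)
  have "sqrt (1 + s\<^sup>2) = c" using c s zz by simp
  note e = exp_param[of s, unfolded this]
  define b where "b = (1 / s) *\<^sub>R z"
  have "y = geodesic a b (s + c)" using s(1) by (simp add: geodesic_def e b_def z_def)
  moreover have "lor b b = 1" using s p
      by (simp add: b_def lor_simps power2_eq_square[symmetric] field_simps)
  moreover have "lor b a = 0" using za by (simp add: b_def lor_simps)
  moreover have "lor b \<nu> = 0" if "lor a \<nu> = 0" "lor y \<nu> = 0" for \<nu>
    using that by (simp add: b_def z_def lor_simps)
  ultimately show ?thesis using that[of b "s + c"] e(1) by blast
qed

section \<open>Laurent polynomials along geodesics\<close>

lemma poly_bounded_imp_const:
  fixes p :: "real poly"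
  assumes "\<And>u. u > 0 \<Longrightarrow> \<bar>poly p u\<bar> \<le> C"
  shows "degree p = 0"
proof (rule ccontr)
  assume "degree p \<noteq> 0"
  then have "filterlim (poly p) at_infinity at_infinity" by (intro filterlim_poly_at_infinity) simp
  then have "filterlim (poly p) at_infinity at_top"
    by (rule filterlim_mono) (simp_all add: at_top_le_at_infinity)
  then have "\<forall>\<^sub>F u in at_top. norm (poly p u) \<ge> \<bar>C\<bar> + 1"
    unfolding filterlim_at_infinity[OF order_refl]
        by (metis abs_ge_zero add_nonneg_pos zero_less_one)
  then have "\<forall>\<^sub>F u in at_top. norm (poly p u) \<ge> \<bar>C\<bar> + 1 \<and> u > (0::real)"
    by (intro eventually_conj eventually_gt_at_top)
  then obtain u :: real where "norm (poly p u) \<ge> \<bar>C\<bar> + 1" "u > 0"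
    using eventually_happens'[OF trivial_limit_at_top_linorder] by blast
  with assms[of u] show False by simp
qed

text \<open>For \<open>k > 0\<close> the bound forces a zero at 0; dividing it out leads by
  induction to a bounded polynomial.\<close>

lemma poly_le_power_imp_monom:
  fixes p :: "real poly"
  assumes "\<And>u. u > 0 \<Longrightarrow> \<bar>poly p u\<bar> \<le> C * u ^ k"
  shows "\<exists>c. \<forall>u. poly p u = c * u ^ k"
  using assms
proof (induction k arbitrary: p)
  case 0
  then have "degree p = 0" by (intro poly_bounded_imp_const[of p C]) simp
  then obtain c where "p = [:c:]" by (rule degree_eq_zeroE)
  then show ?case by simp
next
  case (Suc k)
  have "((\<lambda>u. poly p u) \<longlongrightarrow> 0) (at_right 0)"
  proof (rule Lim_null_comparison)
    show "\<forall>\<^sub>F u in at_right 0. norm (poly p u) \<le> C * u ^ Suc k"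
      using Suc.prems by (auto simp: eventually_at_right_less eventually_at_filter)
    have "((\<lambda>u. C * u ^ Suc k) \<longlongrightarrow> C * 0 ^ Suc k) (at_right 0)" by (intro tendsto_intros)
    then show "((\<lambda>u. C * u ^ Suc k) \<longlongrightarrow> 0) (at_right (0::real))" by simp
  qed
  moreover have "((\<lambda>u. poly p u) \<longlongrightarrow> poly p 0) (at_right 0)" by (intro tendsto_intros)
  ultimately have "poly p 0 = 0" by (intro tendsto_unique[of "at_right (0::real)"]) auto
  then obtain q where q: "p = [:0, 1:] * q"
    by (metis dvdE minus_zero poly_eq_0_iff_dvd)
  have "\<bar>poly q u\<bar> \<le> C * u ^ k" if "u > 0" for u
  proof -
    have "u * \<bar>poly q u\<bar> \<le> u * (C * u ^ k)"
      using Suc.prems[OF that] that by (simp add: q abs_mult mult_ac)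
    then show ?thesis using that by simp
  qed
  from Suc.IH[OF this] obtain c where "\<forall>u. poly q u = c * u ^ k" by blast
  then show ?case by (intro exI[of _ c]) (simp add: q)
qed

text \<open>The factor \<open>u ^ k\<close> clears denominators: by homogeneity it moves inside,
  where \<open>u\<close> times the point is a quadratic curve. The shift \<open>z\<close> and scale
  \<open>r\<close> admit curves at constant distance from a wall.\<close>

lemma tensor_eval_geodesic_poly:
  obtains p where "\<And>u. u > 0 \<Longrightarrow> u ^ k * tensor_eval k T (z + r *\<^sub>R geodesic a b u) = poly p u"
proof -
  obtain p where p: "tensor_eval k T ((r / 2) *\<^sub>R (a - b) + u *\<^sub>R z + u\<^sup>2 *\<^sub>R ((r / 2) *\<^sub>R (a + b)))
      = poly p u" for u
    using tensor_eval_curve_poly by metis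
  have "u *\<^sub>R (z + r *\<^sub>R geodesic a b u)
      = (r / 2) *\<^sub>R (a - b) + u *\<^sub>R z + u\<^sup>2 *\<^sub>R ((r / 2) *\<^sub>R (a + b))"
    if "u > 0" for u
    using that by (simp add: geodesic_def vec_eq_iff field_simps power2_eq_square)
  then show ?thesis using that p by (metis tensor_eval_homogeneous)
qed

lemma tensor_eval_bounded_on_geodesic_imp_const:
  assumes "\<And>u. u > 0 \<Longrightarrow> \<bar>tensor_eval k T (z + r *\<^sub>R geodesic a b u)\<bar> \<le> C" "u > 0"
  shows "tensor_eval k T (z + r *\<^sub>R geodesic a b u) = tensor_eval k T (z + r *\<^sub>R a)"
proof -
  obtain p where p: "\<And>u. u > 0 \<Longrightarrow> u ^ k * tensor_eval k T (z + r *\<^sub>R geodesic a b u) = poly p u"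
    using tensor_eval_geodesic_poly[of k T z r a b] by blast
  have "\<bar>poly p u\<bar> \<le> C * u ^ k" if "u > 0" for u
    using assms(1)[OF that] that by (simp add: p[symmetric] abs_mult mult.commute)
  from poly_le_power_imp_monom[OF this] obtain c where c: "\<And>u. poly p u = c * u ^ k" by blast
  have "tensor_eval k T (z + r *\<^sub>R geodesic a b u) = c" if "u > 0" for u
    using p[OF that] that by (simp add: c)
  from this[OF assms(2)] this[of 1] show ?thesis by simp
qed

text \<open>\<open>w\<close> is the foot of the perpendicular from \<open>y\<close>; thus each level
  set of \<open>lor y \<nu>\<close> is a rescaled and shifted copy of the hyperplane.\<close>

lemma hyp_space_decompose:
  assumes "y \<in> hyp_space" "lor \<nu> \<nu> = 1"
  obtains w where "w \<in> hyperplane_H \<nu>" "y = lor y \<nu> *\<^sub>R \<nu> + sqrt (1 + (lor y \<nu>)\<^sup>2) *\<^sub>R w"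
proof -
  define s where "s = lor y \<nu>"
  define r where "r = sqrt (1 + s\<^sup>2)"
  have r: "r > 0" "r\<^sup>2 = 1 + s\<^sup>2" by (simp_all add: r_def add_pos_nonneg)
  define w where "w = (1 / r) *\<^sub>R (y - s *\<^sub>R \<nu>)"
  have y: "y = s *\<^sub>R \<nu> + r *\<^sub>R w" using r by (simp add: w_def)
  have w\<nu>: "lor w \<nu> = 0" using assms(2) by (simp add: w_def lor_simps s_def)
  have "lor (y - s *\<^sub>R \<nu>) (y - s *\<^sub>R \<nu>) = - r\<^sup>2"
    using hyp_spaceD(1)[OF assms(1)] assms(2) unfolding r(2)
    by (simp add: lor_simps s_def[symmetric] lor_commute[of \<nu> y] power2_eq_square)
  moreover have "lor w w = (1 / r) * ((1 / r) * lor (y - s *\<^sub>R \<nu>) (y - s *\<^sub>R \<nu>))"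
    unfolding w_def lor_scaleR_left lor_scaleR_right ..
  ultimately have "lor w w = - 1" using r(1) by (simp add: power2_eq_square)
  moreover from this have "lor w y < 0" using w\<nu> r(1) by (subst y) (simp add: lor_simps)
  ultimately have "w \<in> hyp_space" by (intro hyp_spaceI[OF _ assms(1)])
  then have "w \<in> hyperplane_H \<nu>" using w\<nu> by (simp add: hyperplane_H_def)
  then show ?thesis using that y unfolding r_def s_def by blast
qed

lemma hyp_space_level:
  fixes \<nu> :: "('n::finite) vec1"
  assumes "lor \<nu> \<nu> = 1"
  obtains w where "\<And>s. geodesic w \<nu> (s + sqrt (1 + s\<^sup>2)) \<in> hyp_space"
    "\<And>s. lor (geodesic w \<nu> (s + sqrt (1 + s\<^sup>2))) \<nu> = s"
proof -
  obtain w where "w \<in> hyperplane_H \<nu>" using hyperplane_nonempty[OF assms] .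
  then have w: "w \<in> hyp_space" "lor w \<nu> = 0" by (auto simp: hyperplane_H_def)
  show ?thesis
  proof (rule that[of w])
    fix s
    show "geodesic w \<nu> (s + sqrt (1 + s\<^sup>2)) \<in> hyp_space"
      using w assms exp_param(1)[of s] by (intro geodesic_hyp_space) (simp_all add: lor_commute)
    show "lor (geodesic w \<nu> (s + sqrt (1 + s\<^sup>2))) \<nu> = s"
      unfolding lor_geodesic w(2) assms exp_param(2) by simp
  qed
qed

lemma geodesic_levels_infinite:
  assumes "lor a \<nu> \<noteq> 0" shows "infinite ((\<lambda>u. lor (geodesic a b u) \<nu>) ` {0<..})"
proof
  define \<alpha> \<beta> where "\<alpha> = (lor a \<nu> + lor b \<nu>) / 2" and "\<beta> = (lor a \<nu> - lor b \<nu>) / 2"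
  assume fin: "finite ((\<lambda>u. lor (geodesic a b u) \<nu>) ` {0<..})" (is "finite ?S")
  \<comment> \<open>A level \<open>s\<close> is attained only at roots of a quadratic, which is
    nonzero since \<open>\<alpha> + \<beta> = lor a \<nu>\<close>; so finitely many levels would
    leave finitely many parameters.\<close>
  have "poly [:\<beta>, - lor (geodesic a b u) \<nu>, \<alpha>:] u = 0" if "u > 0" for u
    using that unfolding lor_geodesic \<alpha>_def \<beta>_def by (simp add: field_simps)
  then have "{0<..} \<subseteq> (\<Union>s\<in>?S. {u. poly [:\<beta>, - s, \<alpha>:] u = 0})" by auto
  moreover have "[:\<beta>, - s, \<alpha>:] \<noteq> 0" for s using assms by (auto simp: \<alpha>_def \<beta>_def)
  then have "finite (\<Union>s\<in>?S. {u. poly [:\<beta>, - s, \<alpha>:] u = 0})"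
    using fin by (intro finite_UN_I poly_roots_finite)
  ultimately have "finite {0::real<..}" by (rule finite_subset)
  then show False by (simp add: infinite_Ioi)
qed

text \<open>On the geodesic perpendicular to the hyperplane, which meets every level,
  \<open>T\<close> is a Laurent polynomial. It equals \<open>\<kappa>\<close> at the infinitely many
  levels met by the given geodesic, hence everywhere.\<close>

lemma tensor_eval_const_if_const_on_geodesic:
  fixes \<nu> :: "('n::finite) vec1"
  assumes \<nu>: "lor \<nu> \<nu> = 1"
    and level: "\<And>y y'. y \<in> hyp_space \<Longrightarrow> y' \<in> hyp_space \<Longrightarrow> lor y \<nu> = lor y' \<nu> \<Longrightarrow> tensor_eval k T y
        = tensor_eval k T y'"
    and a: "a \<in> hyp_space" "lor b b = 1" "lor b a = 0" "lor a \<nu> \<noteq> 0"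
    and const: "\<And>u. u > 0 \<Longrightarrow> tensor_eval k T (geodesic a b u) = \<kappa>"
    and y: "y \<in> hyp_space"
  shows "tensor_eval k T y = \<kappa>"
proof -
  obtain w where w: "\<And>s. geodesic w \<nu> (s + sqrt (1 + s\<^sup>2)) \<in> hyp_space"
    "\<And>s. lor (geodesic w \<nu> (s + sqrt (1 + s\<^sup>2))) \<nu> = s"
    by (rule hyp_space_level[OF \<nu>]) blast
  obtain p where p: "\<And>v. v > 0 \<Longrightarrow> v ^ k * tensor_eval k T (geodesic w \<nu> v) = poly p v"
    using tensor_eval_geodesic_poly[of k T 0 1 w \<nu>] by auto
  let ?v = "\<lambda>s::real. s + sqrt (1 + s\<^sup>2)"
  let ?S = "(\<lambda>u. lor (geodesic a b u) \<nu>) ` {0<..}"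
  have "poly p v = poly (monom \<kappa> k) v" if "v \<in> ?v ` ?S" for v
  proof -
    from that obtain u where u: "u > 0" "v = ?v (lor (geodesic a b u) \<nu>)" by auto
    have "v > 0" unfolding u(2) by (rule exp_param(1))
    have "tensor_eval k T (geodesic w \<nu> v) = tensor_eval k T (geodesic a b u)"
      unfolding u(2) by (intro level w geodesic_hyp_space[OF a(1-3) u(1)])
    then show ?thesis using p[OF \<open>v > 0\<close>] const[OF u(1)] by (simp add: poly_monom mult.commute)
  qed
  then have "?v ` ?S \<subseteq> {v. poly (p - monom \<kappa> k) v = 0}" by auto
  moreover have "inj ?v"
    by (rule inj_on_inverseI[where g = "\<lambda>v. (v - 1 / v) / 2"]) (rule exp_param(2))
  then have "infinite (?v ` ?S)"
    using geodesic_levels_infinite[OF a(4)] by (metis finite_imageD inj_on_subset subset_UNIV)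
  ultimately have "p - monom \<kappa> k = 0" using poly_roots_finite finite_subset by blast
  then have "p = monom \<kappa> k" by simp
  then have c: "tensor_eval k T (geodesic w \<nu> v) = \<kappa>" if "v > 0" for v
    using p[OF that] that by (simp add: poly_monom mult.commute)
  have "tensor_eval k T y = tensor_eval k T (geodesic w \<nu> (?v (lor y \<nu>)))"
    by (intro level y w(1) w(2)[symmetric])
  also have "\<dots> = \<kappa>" by (intro c exp_param(1))
  finally show ?thesis .
qed

text \<open>On hyperbolic space \<open>lor y y = -1\<close> and \<open>lor y \<nu>\<close> takes
  every real value, so the zonal polynomial becomes a monic polynomial of degree \<open>k\<close> in
  one variable.\<close>

lemma zonal_not_const:
  fixes \<nu> :: "('n::finite) vec1"
  assumes \<nu>: "lor \<nu> \<nu> = 1" and "k \<ge> 1"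
  shows "\<not> (\<forall>y\<in>hyp_space. tensor_eval k (zonal_tensor k \<nu>) y = \<kappa>)"
proof
  assume const: "\<forall>y\<in>hyp_space. tensor_eval k (zonal_tensor k \<nu>) y = \<kappa>"
  obtain w where w: "\<And>s. geodesic w \<nu> (s + sqrt (1 + s\<^sup>2)) \<in> hyp_space"
    "\<And>s. lor (geodesic w \<nu> (s + sqrt (1 + s\<^sup>2))) \<nu> = s"
    by (rule hyp_space_level[OF \<nu>]) blast
  define P where "P = (\<Sum>j\<le>k div 2. monom (gegenbauer_coeff CARD('n option) k j * (- 1) ^ j) (k
      - 2 * j))"
  have "poly P s = poly [:\<kappa>:] s" for s
  proof -
    let ?y = "geodesic w \<nu> (s + sqrt (1 + s\<^sup>2))"
    have y: "?y \<in> hyp_space" "lor ?y \<nu> = s" by (rule w)+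
    have "poly P s = tensor_eval k (zonal_tensor k \<nu>) ?y"
      unfolding tensor_eval_zonal_tensor y(2) hyp_spaceD(1)[OF y(1)]
      by (simp add: P_def poly_sum poly_monom mult_ac)
    also have "\<dots> = \<kappa>" using const y(1) by blast
    finally show ?thesis by simp
  qed
  then have "P = [:\<kappa>:]" by (simp add: poly_eq_poly_eq_iff[symmetric] fun_eq_iff)
  then have "coeff P k = 0" using assms(2) by (simp add: coeff_pCons split: nat.split)
  moreover have "coeff P k = (\<Sum>j\<le>k div 2. if j = 0 then 1 else 0)"
    unfolding P_def coeff_sum using assms(2) by (intro sum.cong) (auto simp: coeff_monom)
  ultimately show False by simp
qed

subsection \<open>Crossing cocycles\<close>

definition heaviside :: "real \<Rightarrow> real" where "heaviside s = (if s > 0 then 1 else 0)"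

lemma abs_heaviside_diff: "\<bar>heaviside a - heaviside b\<bar> \<le> 1"
  by (simp add: heaviside_def)

lemma tensor_act_sum:
  "tensor_act k A (\<lambda>f. \<Sum>i\<in>I. c i * T i f) = (\<lambda>f. \<Sum>i\<in>I. c i * tensor_act k A (T i) f)"
  unfolding tensor_act_def sum_distrib_left by (subst sum.swap) (simp only: mult.left_commute)

lemma tensor_act_add:
  "tensor_act k A (\<lambda>f. T f + U f) = (\<lambda>f. tensor_act k A T f + tensor_act k A U f)"
  by (simp add: tensor_act_def algebra_simps sum.distrib)

lemma tensor_eval_zonal_tensor_cong:
  fixes y y' \<nu> :: "('n::finite) vec1"
  shows "y \<in> hyp_space \<Longrightarrow> y' \<in> hyp_space \<Longrightarrow> lor y \<nu> = lor y' \<nu> \<Longrightarrow>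
    tensor_eval k (zonal_tensor k \<nu>) y = tensor_eval k (zonal_tensor k \<nu>) y'"
  by (simp add: tensor_eval_zonal_tensor hyp_spaceD)

text \<open>Each wall has one normal in \<open>N\<close>: opposite normals share a nonempty
  hyperplane, which \<open>disjoint\<close> excludes. With \<open>invariant\<close>, the group
  therefore preserves the chosen sides of the walls.\<close>

locale hyperplane_action =
  fixes G :: "('n::finite) mat1 set" and N :: "'n vec1 set"
  assumes dim: "CARD('n) \<ge> 2"
    and lorentz: "A \<in> G \<Longrightarrow> lor (A *v x) (A *v y) = lor x y"
    and hyp: "A \<in> G \<Longrightarrow> x \<in> hyp_space \<Longrightarrow> A *v x \<in> hyp_space"
    and inverse: "A \<in> G \<Longrightarrow> \<exists>B\<in>G. (\<forall>x. A *v (B *v x) = x) \<and> (\<forall>x. B *v (A *v x) = x)"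
    and unit: "\<nu> \<in> N \<Longrightarrow> lor \<nu> \<nu> = 1"
    and nonempty: "N \<noteq> {}"
    and invariant: "A \<in> G \<Longrightarrow> \<nu> \<in> N \<Longrightarrow> A *v \<nu> \<in> N"
    and disjoint: "\<mu> \<in> N \<Longrightarrow> \<nu> \<in> N \<Longrightarrow> \<mu> \<noteq> \<nu> \<Longrightarrow> hyperplane_H \<mu> \<inter> hyperplane_H \<nu> = {}"
    and locally_finite: "compact K \<Longrightarrow> K \<subseteq> hyp_space \<Longrightarrow> finite {\<nu> \<in> N. hyperplane_H \<nu> \<inter> K \<noteq> {}}"
    and cocompact: "\<exists>K. compact K \<and> K \<subseteq> hyp_space \<and> (\<forall>x\<in>hyp_space. \<exists>A\<in>G. \<exists>y\<in>K. x = A *v y)"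
begin

definition separating :: "'n vec1 \<Rightarrow> 'n vec1 \<Rightarrow> 'n vec1 set" where
  "separating x y = {\<nu> \<in> N. (lor x \<nu> > 0) \<noteq> (lor y \<nu> > 0)}"

lemma separating_crossing:
  assumes "\<nu> \<in> separating x y"
  obtains t where "0 \<le> t" "t \<le> 1" "lor (segment x y t) \<nu> = 0"
  using assms linear_sign_change[of "lor x \<nu>" "lor y \<nu>"] by (auto simp: separating_def lor_segment)

lemma separating_subset_meeting:
  assumes "\<And>t. 0 \<le> t \<Longrightarrow> t \<le> 1 \<Longrightarrow> hyp_normalize (segment x y t) \<in> L" "x \<in> hyp_space" "y \<in> hyp_space"
  shows "separating x y \<subseteq> {\<nu> \<in> N. hyperplane_H \<nu> \<inter> L \<noteq> {}}"
proof
  fix \<nu> assume \<nu>: "\<nu> \<in> separating x y"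
  then obtain t where t: "0 \<le> t" "t \<le> 1" "lor (segment x y t) \<nu> = 0" by (rule separating_crossing)
  then have "hyp_normalize (segment x y t) \<in> hyperplane_H \<nu> \<inter> L"
    using assms by (simp add: hyp_normalize_segment_in_hyperplane)
  then show "\<nu> \<in> {\<nu> \<in> N. hyperplane_H \<nu> \<inter> L \<noteq> {}}" using \<nu> by (auto simp: separating_def)
qed

lemma finite_meeting_segment:
  assumes "x \<in> hyp_space" "y \<in> hyp_space"
  shows "finite {\<nu> \<in> N. \<exists>t. 0 \<le> t \<and> t \<le> 1 \<and> lor (segment x y t) \<nu> = 0}"
proof -
  obtain L where L: "compact L" "L \<subseteq> hyp_space"
    "\<And>a b t. a \<in> {x, y} \<Longrightarrow> b \<in> {x, y} \<Longrightarrow> 0 \<le> t \<Longrightarrow> t \<le> 1 \<Longrightarrow> hyp_normalize (segment a b t) \<in> L"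
    by (rule compact_join[of "{x, y}"]) (use assms in auto)
  have "hyp_normalize (segment x y t) \<in> hyperplane_H \<nu> \<inter> L" if "0 \<le> t" "t
      \<le> 1" "lor (segment x y t) \<nu> = 0" for t \<nu>
    using that assms L(3)[of x y t] by (simp add: hyp_normalize_segment_in_hyperplane)
  then have "{\<nu> \<in> N. \<exists>t. 0 \<le> t \<and> t \<le> 1 \<and> lor (segment x y t) \<nu> = 0}
      \<subseteq> {\<nu> \<in> N. hyperplane_H \<nu> \<inter> L \<noteq> {}}" by blast
  then show ?thesis using locally_finite[OF L(1,2)] finite_subset by blast
qed

lemma finite_separating:
  assumes "x \<in> hyp_space" "y \<in> hyp_space" shows "finite (separating x y)"
proof (rule finite_subset[OF _ finite_meeting_segment[OF assms]], rule subsetI)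
  fix \<nu> assume \<nu>: "\<nu> \<in> separating x y"
  then show "\<nu> \<in> {\<nu> \<in> N. \<exists>t. 0 \<le> t \<and> t \<le> 1 \<and> lor (segment x y t) \<nu> = 0}"
    by (rule separating_crossing) (use \<nu> in \<open>auto simp: separating_def\<close>)
qed

definition crossing_sum :: "nat \<Rightarrow> 'n vec1 \<Rightarrow> 'n vec1 \<Rightarrow> 'n tensor" where
  "crossing_sum k x y = (\<lambda>f. \<Sum>\<nu>\<in>separating x y. (heaviside (lor y \<nu>)
      - heaviside (lor x \<nu>)) * zonal_tensor k \<nu> f)"

text \<open>Walls that do not separate contribute 0. A common index set lets sums for different
  pairs of points be added.\<close>

lemma crossing_sum_superset:
  assumes "finite E" "separating x y \<subseteq> E" "E \<subseteq> N"
  shows "crossing_sum k x y = (\<lambda>f. \<Sum>\<nu>\<in>E. (heaviside (lor y \<nu>)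
      - heaviside (lor x \<nu>)) * zonal_tensor k \<nu> f)"
proof
  fix f
  show "crossing_sum k x y f = (\<Sum>\<nu>\<in>E. (heaviside (lor y \<nu>)
      - heaviside (lor x \<nu>)) * zonal_tensor k \<nu> f)"
    unfolding crossing_sum_def using assms
    by (intro sum.mono_neutral_left) (auto simp: separating_def heaviside_def)
qed

lemma crossing_sum_add:
  assumes "x \<in> hyp_space" "y \<in> hyp_space" "z \<in> hyp_space"
  shows "crossing_sum k x z = (\<lambda>f. crossing_sum k x y f + crossing_sum k y z f)"
proof -
  define E where "E = separating x y \<union> separating y z \<union> separating x z"
  have E: "finite E" "E \<subseteq> N" "separating x y \<subseteq> E" "separating y z \<subseteq> E" "separating x z \<subseteq> E"
    using finite_separating assms by (auto simp: E_def) (auto simp: separating_def)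
  show ?thesis
    unfolding crossing_sum_superset[OF E(1,3,2)] crossing_sum_superset[OF E(1,4,2)] crossing_sum_superset[OF E(1,5,2)]
      sum.distrib[symmetric] by (simp add: algebra_simps)
qed

lemma crossing_sum_sym_trfree: "crossing_sum k x y \<in> sym_trfree k"
  unfolding crossing_sum_def
  by (intro sym_trfree_sum sym_trfree_scale zonal_tensor_sym_trfree unit) (simp add: separating_def)

text \<open>\<open>A\<close> carries walls to walls together with their chosen normals, so the signs
  of the crossings are preserved.\<close>

lemma crossing_sum_act:
  assumes A: "A \<in> G" shows "tensor_act k A (crossing_sum k x y) = crossing_sum k (A *v x) (A *v y)"
proof -
  obtain B where B: "B \<in> G" "\<And>x. A *v (B *v x) = x" "\<And>x. B *v (A *v x) = x"
    using inverse[OF A] by blast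
  have "surj ((*v) A)" using B(2) by (metis surjI)
  note act = tensor_act_zonal_tensor[OF lorentz[OF A] this]
  have lA: "lor (A *v x) \<nu> = lor x (B *v \<nu>)" for x \<nu>
    using lorentz[OF A, of x "B *v \<nu>"] B(2) by simp
  have bij: "bij_betw ((*v) A) (separating x y) (separating (A *v x) (A *v y))"
    using B invariant[OF A] invariant[OF B(1)]
    by (intro bij_betw_byWitness[where f' = "(*v) B"]) (auto simp: separating_def lA)
  have "crossing_sum k (A *v x) (A *v y) = (\<lambda>f. \<Sum>\<nu>\<in>separating x y.
      (heaviside (lor (A *v y) (A *v \<nu>)) - heaviside (lor (A *v x) (A *v \<nu>))) * zonal_tensor k (A *v \<nu>) f)"
    unfolding crossing_sum_def by (subst sum.reindex_bij_betw[OF bij, symmetric]) (rule refl)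
  then show ?thesis unfolding lorentz[OF A] act[symmetric] crossing_sum_def tensor_act_sum by simp
qed

text \<open>Go from \<open>x\<close> to \<open>A *v x\<close>, then along the
  \<open>A\<close>-translate of the way from \<open>x\<close> to \<open>B *v x\<close>.\<close>

lemma crossing_sum_cocycle:
  assumes "A \<in> G" "B \<in> G" "x \<in> hyp_space"
  shows "crossing_sum k x ((A ** B) *v x)
      = (\<lambda>f. crossing_sum k x (A *v x) f + tensor_act k A (crossing_sum k x (B *v x)) f)"
  using crossing_sum_add[of x "A *v x" "A *v (B *v x)"] assms hyp
  by (simp add: crossing_sum_act matrix_vector_mul_assoc[symmetric])

end

section \<open>Consequences of the crossing cocycle being a coboundary\<close>

locale trivialized_cocycle = hyperplane_action G N for G :: "('n::finite) mat1 set" and N +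
  fixes k :: nat and x0 :: "'n vec1" and v :: "'n tensor"
  assumes x0: "x0 \<in> hyp_space"
    and coboundary: "A \<in> G \<Longrightarrow> crossing_sum k x0 (A *v x0) = (\<lambda>f. tensor_act k A v f - v f)"
begin

text \<open>Since \<open>heaviside 0 = 0\<close>, the value at a point of a wall is the one on the negative side of
  this wall.\<close>

definition primitive :: "'n vec1 \<Rightarrow> 'n tensor" where "primitive x
    = (\<lambda>f. v f + crossing_sum k x0 x f)"

text \<open>Split the crossing sum at \<open>A *v x0\<close>: by \<open>coboundary\<close> the first
  part is the change of \<open>v\<close> under \<open>A\<close>, and the second is a
  translate.\<close>

lemma primitive_equivariant:
  assumes A: "A \<in> G" and x: "x \<in> hyp_space"
  shows "tensor_eval k (primitive (A *v x)) (A *v z) = tensor_eval k (primitive x) z"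
proof -
  have "crossing_sum k x0 (A *v x) = (\<lambda>f. crossing_sum k x0 (A *v x0) f
      + crossing_sum k (A *v x0) (A *v x) f)"
    by (rule crossing_sum_add) (use hyp A x x0 in auto)
  then have "primitive (A *v x) = tensor_act k A (primitive x)"
    unfolding primitive_def tensor_act_add crossing_sum_act[OF A] coboundary[OF A] by simp
  then show ?thesis by (simp add: tensor_eval_tensor_act lorentz[OF A])
qed

lemma primitive_step:
  assumes "x \<in> hyp_space" "y \<in> hyp_space" "finite E" "separating x y \<subseteq> E" "E \<subseteq> N"
  shows "tensor_eval k (primitive y) z = tensor_eval k (primitive x) z
    + (\<Sum>\<nu>\<in>E. (heaviside (lor y \<nu>) - heaviside (lor x \<nu>)) * tensor_eval k (zonal_tensor k \<nu>) z)"
proof -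
  have "primitive y = (\<lambda>f. primitive x f + crossing_sum k x y f)"
    unfolding primitive_def crossing_sum_add[OF x0 assms(1,2)] by (simp add: add.assoc)
  then show ?thesis by (simp add: tensor_eval_add crossing_sum_superset[OF assms(3-5)] tensor_eval_sum tensor_eval_scale)
qed

text \<open>Equivariance moves \<open>x\<close> into \<open>K\<close>. There only the finitely many
  walls meeting \<open>L\<close> matter, and the point of evaluation stays in a compact set. The
  case \<open>\<mu> = 0\<close> covers evaluation at \<open>r *\<^sub>R x\<close> for arbitrary
  \<open>x\<close>.\<close>

lemma primitive_bounded:
  obtains C where "\<And>x \<mu>. x \<in> hyp_space \<Longrightarrow> \<mu> \<in> insert 0 N \<Longrightarrow> lor x \<mu> = 0 \<Longrightarrow>
     \<bar>tensor_eval k (primitive x) (s *\<^sub>R \<mu> + r *\<^sub>R x)\<bar> \<le> C"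
proof -
  obtain K where K: "compact K" "K \<subseteq> hyp_space"
    and cover: "\<And>x. x \<in> hyp_space \<Longrightarrow> \<exists>A\<in>G. \<exists>y\<in>K. x = A *v y" using cocompact by blast
  obtain L where L: "compact L" "L \<subseteq> hyp_space" "insert x0 K \<subseteq> L"
    "\<And>x y t. x \<in> insert x0 K \<Longrightarrow> y \<in> insert x0 K \<Longrightarrow> 0 \<le> t \<Longrightarrow> t \<le> 1 \<Longrightarrow> hyp_normalize (segment x y t) \<in> L"
    using compact_join[of "insert x0 K"] K x0 by (metis compact_insert insert_subset)
  define E where "E = {\<nu> \<in> N. hyperplane_H \<nu> \<inter> L \<noteq> {}}"
  have E: "finite E" unfolding E_def by (rule locally_finite[OF L(1,2)])
  define b where "b z = \<bar>tensor_eval k v z\<bar> + (\<Sum>\<nu>\<in>E. \<bar>tensor_eval k (zonal_tensor k \<nu>) z\<bar>)" for z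
  have primitive_le: "\<bar>tensor_eval k (primitive y) z\<bar> \<le> b z" if "y \<in> K" for y z
  proof -
    have "separating x0 y \<subseteq> E" unfolding E_def
      using L(4)[of x0 y] that K(2) x0 by (intro separating_subset_meeting) auto
    then have "tensor_eval k (primitive y) z = tensor_eval k v z
        + (\<Sum>\<nu>\<in>E. (heaviside (lor y \<nu>) - heaviside (lor x0 \<nu>)) * tensor_eval k (zonal_tensor k \<nu>) z)"
      unfolding primitive_def tensor_eval_add using E
          by (subst crossing_sum_superset) (auto simp: E_def tensor_eval_sum tensor_eval_scale)
    also have "\<bar>\<dots>\<bar> \<le> \<bar>tensor_eval k v z\<bar>
        + (\<Sum>\<nu>\<in>E. \<bar>(heaviside (lor y \<nu>) - heaviside (lor x0 \<nu>)) * tensor_eval k (zonal_tensor k \<nu>) z\<bar>)"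
      by (intro order_trans[OF abs_triangle_ineq] add_left_mono sum_abs)
    also have "\<dots> \<le> b z"
      unfolding b_def abs_mult
      by (intro add_left_mono sum_mono mult_left_le_one_le abs_ge_zero abs_heaviside_diff)
    finally show ?thesis .
  qed
  define X where "X = (\<Union>\<mu>\<in>insert 0 E. (\<lambda>y. s *\<^sub>R \<mu> + r *\<^sub>R y) ` K)"
  have "compact X" unfolding X_def
    using E K by (intro compact_UN compact_continuous_image continuous_intros) auto
  moreover have "continuous_on X b"
    unfolding b_def by (intro continuous_intros continuous_tensor_eval)
  ultimately have "bounded (b ` X)" by (intro compact_imp_bounded compact_continuous_image)
  then obtain C where C: "\<And>z. z \<in> X \<Longrightarrow> \<bar>b z\<bar> \<le> C"
    unfolding bounded_iff by auto
  show ?thesis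
  proof (rule that[of C])
    fix x \<mu> assume x: "x \<in> hyp_space" and \<mu>: "\<mu> \<in> insert 0 N" "lor x \<mu> = 0"
    from cover[OF x] obtain A y where A: "A \<in> G" "y \<in> K" "x = A *v y" by blast
    obtain B where B: "B \<in> G" "\<And>x. A *v (B *v x) = x" using inverse[OF A(1)] by blast
    have y: "y \<in> hyp_space" using A(2) K(2) by blast
    have \<mu>': "B *v \<mu> \<in> insert 0 E"
    proof (cases "\<mu> = 0")
      case False
      then have "B *v \<mu> \<in> N" using \<mu>(1) invariant[OF B(1)] by blast
      moreover have "lor y (B *v \<mu>) = 0"
        using lorentz[OF A(1), of y "B *v \<mu>"] \<mu>(2) A(3) B(2) by simp
      then have "y \<in> hyperplane_H (B *v \<mu>) \<inter> L"
        using y A(2) L(3) by (auto simp: hyperplane_H_def)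
      ultimately show ?thesis by (auto simp: E_def)
    qed simp
    have "s *\<^sub>R \<mu> + r *\<^sub>R x = A *v (s *\<^sub>R (B *v \<mu>) + r *\<^sub>R y)"
      by (simp add: matrix_vector_right_distrib matrix_vector_mult_scaleR B(2) A(3))
    then have "tensor_eval k (primitive x) (s *\<^sub>R \<mu> + r *\<^sub>R x)
        = tensor_eval k (primitive y) (s *\<^sub>R (B *v \<mu>) + r *\<^sub>R y)"
      using primitive_equivariant[OF A(1) y] A(3) by simp
    moreover have "s *\<^sub>R (B *v \<mu>) + r *\<^sub>R y \<in> X" using \<mu>' A(2) unfolding X_def by blast
    ultimately show "\<bar>tensor_eval k (primitive x) (s *\<^sub>R \<mu> + r *\<^sub>R x)\<bar> \<le> C"
      using order_trans[OF primitive_le[OF A(2)] abs_le_D1[OF C]] by simp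
  qed
qed

text \<open>The chord projects into the wall, so any wall separating its ends would meet that
  wall.\<close>

lemma primitive_const_on_hyperplane:
  assumes \<mu>: "\<mu> \<in> N" and x: "x \<in> hyperplane_H \<mu>" and y: "y \<in> hyperplane_H \<mu>"
  shows "tensor_eval k (primitive y) z = tensor_eval k (primitive x) z"
proof -
  have h: "x \<in> hyp_space" "y \<in> hyp_space" "lor x \<mu> = 0" "lor y \<mu> = 0"
    using x y by (auto simp: hyperplane_H_def)
  have "separating x y = {}"
  proof (rule equals0I)
    fix \<nu> assume \<nu>: "\<nu> \<in> separating x y"
    then obtain t where t: "0 \<le> t" "t \<le> 1" "lor (segment x y t) \<nu> = 0" by (rule separating_crossing)
    then have "hyp_normalize (segment x y t) \<in> hyperplane_H \<nu> \<inter> hyperplane_H \<mu>"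
      using h by (simp add: hyp_normalize_segment_in_hyperplane lor_segment)
    moreover have "\<nu> \<in> N" "\<nu> \<noteq> \<mu>" using \<nu> h by (auto simp: separating_def)
    ultimately show False using disjoint[OF _ \<mu>] by blast
  qed
  then show ?thesis using primitive_step[OF h(1,2), of "{}"] by simp
qed

text \<open>Points of equal level lie over feet \<open>w\<close>, \<open>w'\<close> in the wall. On
  the geodesic through these the primitive is the same as at \<open>x\<close>, so its polynomial is
  bounded on the equidistant curve above, hence constant there.\<close>

lemma primitive_depends_on_level:
  assumes \<mu>: "\<mu> \<in> N" and x: "x \<in> hyperplane_H \<mu>"
    and y: "y \<in> hyp_space" "y' \<in> hyp_space" "lor y \<mu> = lor y' \<mu>"
  shows "tensor_eval k (primitive x) y = tensor_eval k (primitive x) y'"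
proof -
  define s r where "s = lor y \<mu>" and "r = sqrt (1 + s\<^sup>2)"
  obtain w where w: "w \<in> hyperplane_H \<mu>" "y = s *\<^sub>R \<mu> + r *\<^sub>R w"
    unfolding r_def s_def by (rule hyp_space_decompose[OF y(1) unit[OF \<mu>]])
  obtain w' where w': "w' \<in> hyperplane_H \<mu>" "y' = s *\<^sub>R \<mu> + r *\<^sub>R w'"
    unfolding r_def s_def y(3) by (rule hyp_space_decompose[OF y(2) unit[OF \<mu>]])
  show ?thesis
  proof (cases "w = w'")
    case False
    have hw: "w \<in> hyp_space" "w' \<in> hyp_space" "lor w \<mu> = 0" "lor w' \<mu> = 0"
      using w(1) w'(1) by (auto simp: hyperplane_H_def)
    obtain b u where b: "lor b b = 1" "lor b w = 0" "u > 0" "w' = geodesic w b u" "lor b \<mu> = 0"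
      using geodesic_join[OF hw(1,2) False] hw(3,4) by metis
    have geodesic: "geodesic w b t \<in> hyperplane_H \<mu>" if "t > 0" for t
      using geodesic_hyp_space[OF hw(1) b(1,2) that]
          by (simp add: hyperplane_H_def lor_geodesic hw b)
    obtain C where C: "\<And>x \<mu>. x \<in> hyp_space \<Longrightarrow> \<mu> \<in> insert 0 N \<Longrightarrow> lor x \<mu> = 0 \<Longrightarrow>
       \<bar>tensor_eval k (primitive x) (s *\<^sub>R \<mu> + r *\<^sub>R x)\<bar> \<le> C" using primitive_bounded[of s r] by blast
    have "tensor_eval k (primitive x) (s *\<^sub>R \<mu> + r *\<^sub>R geodesic w b u)
        = tensor_eval k (primitive x) (s *\<^sub>R \<mu> + r *\<^sub>R w)"
    proof (rule tensor_eval_bounded_on_geodesic_imp_const[OF _ b(3)])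
      fix t :: real assume t: "t > 0"
      show "\<bar>tensor_eval k (primitive x) (s *\<^sub>R \<mu> + r *\<^sub>R geodesic w b t)\<bar> \<le> C"
        using C[of "geodesic w b t" \<mu>] geodesic[OF t] primitive_const_on_hyperplane[OF \<mu> x geodesic[OF t]] \<mu>
        by (simp add: hyperplane_H_def)
    qed
    then show ?thesis using w w' b(4) by simp
  qed (use w w' in simp)
qed

lemma side_const:
  fixes \<epsilon> :: real
  assumes \<nu>: "\<nu> \<in> N" and x: "x \<in> hyperplane_H \<nu>" and \<epsilon>: "\<epsilon> = 1 \<or> \<epsilon> = - 1"
  obtains \<kappa> where "\<And>y. y \<in> hyp_space
      \<Longrightarrow> tensor_eval k (primitive x) y + heaviside \<epsilon> * tensor_eval k (zonal_tensor k \<nu>) y = \<kappa>"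
proof -
  \<comment> \<open>The value of the primitive just off the wall on the side
    \<open>\<epsilon>\<close>: the value at \<open>x\<close> is that of the negative side, and the
    positive side adds the jump. It suffices that \<open>P\<close> is constant on one geodesic
    starting off the wall.\<close>
  define P where "P = (\<lambda>f. primitive x f + heaviside \<epsilon> * zonal_tensor k \<nu> f)"
  have P: "tensor_eval k P z = tensor_eval k (primitive x) z
      + heaviside \<epsilon> * tensor_eval k (zonal_tensor k \<nu>) z" for z
    by (simp add: P_def tensor_eval_add tensor_eval_scale)
  have hx: "x \<in> hyp_space" "lor x \<nu> = 0" using x by (auto simp: hyperplane_H_def)
  have ne: "lor x \<omega> \<noteq> 0" if "\<omega> \<in> N" "\<omega> \<noteq> \<nu>" for \<omega>
    using disjoint[OF that(1) \<nu> that(2)] x hx by (auto simp: hyperplane_H_def)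
  have P_level: "tensor_eval k P y = tensor_eval k P y'"
    if "y \<in> hyp_space" "y' \<in> hyp_space" "lor y \<nu> = lor y' \<nu>" for y y'
    unfolding P using primitive_depends_on_level[OF \<nu> x that] tensor_eval_zonal_tensor_cong[OF that] by simp
  have "\<exists>a b. a \<in> hyp_space \<and> lor b b = 1 \<and> lor b a = 0 \<and> lor a \<nu> \<noteq> 0 \<and>
    (\<forall>u>0. tensor_eval k P (geodesic a b u) = tensor_eval k P a)"
  proof (cases "\<exists>y\<in>hyp_space. \<exists>\<mu>\<in>N. \<epsilon> * lor y \<nu> > 0 \<and> lor y \<mu> = 0")
    case True
    then obtain y \<mu> where y: "y \<in> hyp_space" "\<mu> \<in> N" "\<epsilon> * lor y \<nu> > 0" "lor y \<mu> = 0" by blast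
    \<comment> \<open>Of the walls other than \<open>\<nu>\<close> met by the chord, the one met
      first will be \<open>\<rho>\<close>.\<close>
    define E where "E = {\<omega> \<in> N. \<omega> \<noteq> \<nu> \<and> (\<exists>t. 0 \<le> t \<and> t \<le> 1 \<and> lor (segment x y t) \<omega> = 0)}"
    have fin: "finite E"
      by (rule finite_subset[OF _ finite_meeting_segment[OF hx(1) y(1)]]) (auto simp: E_def)
    have "\<mu> \<in> E" using y by (auto simp: E_def lor_segment intro!: exI[of _ 1])
    have "\<forall>\<omega>\<in>E. \<exists>t. 0 \<le> t \<and> t \<le> 1 \<and> lor (segment x y t) \<omega> = 0" by (auto simp: E_def)
    from bchoice[OF this] obtain \<tau> where
      \<tau>: "\<And>\<omega>. \<omega> \<in> E \<Longrightarrow> 0 \<le> \<tau> \<omega> \<and> \<tau> \<omega> \<le> 1 \<and> lor (segment x y (\<tau> \<omega>)) \<omega> = 0" by blast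
    \<comment> \<open>An affine function with two zeros vanishes identically, so \<open>x\<close>
      would lie on \<open>\<omega>\<close>; but \<open>\<nu>\<close> is the only wall through
      \<open>x\<close>.\<close>
    have \<tau>_unique: "t = \<tau> \<omega>" if "\<omega> \<in> E" "lor (segment x y t) \<omega> = 0" for \<omega> t
    proof (rule ccontr)
      assume "t \<noteq> \<tau> \<omega>"
      have "(t - \<tau> \<omega>) * (lor y \<omega> - lor x \<omega>) = lor (segment x y t) \<omega> - lor (segment x y (\<tau> \<omega>)) \<omega>"
        by (simp add: lor_segment algebra_simps)
      also have "\<dots> = 0" using that(2) \<tau>[OF that(1)] by simp
      finally have "lor y \<omega> = lor x \<omega>" using \<open>t \<noteq> \<tau> \<omega>\<close> by simp
      then have "lor x \<omega> = 0" using that(2) by (simp add: lor_segment algebra_simps)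
      then show False using ne that(1) by (auto simp: E_def)
    qed
    have "Min (\<tau> ` E) \<in> \<tau> ` E" using fin \<open>\<mu> \<in> E\<close> by (intro Min_in) auto
    then obtain \<rho> where \<rho>: "\<rho> \<in> E" "\<tau> \<rho> = Min (\<tau> ` E)" by auto
    have \<rho>N: "\<rho> \<in> N" "\<rho> \<noteq> \<nu>" using \<rho>(1) by (auto simp: E_def)
    define t where "t = \<tau> \<rho>"
    have t: "0 \<le> t" "t \<le> 1" "lor (segment x y t) \<rho> = 0" using \<tau>[OF \<rho>(1)] by (auto simp: t_def)
    have "t \<noteq> 0" using t(3) ne[OF \<rho>N] by (auto simp: lor_segment)
    then have "t > 0" using t(1) by simp
    define y1 where "y1 = hyp_normalize (segment x y t)"
    define c where "c = sqrt (- lor (segment x y t) (segment x y t))"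
    have c: "c > 0" using segment_timelike[OF hx(1) y(1) t(1,2)] by (simp add: c_def)
    have lor_y1: "lor y1 \<omega> = lor (segment x y t) \<omega> / c" for \<omega>
      by (simp add: y1_def c_def lor_hyp_normalize_left)
    have y1: "y1 \<in> hyp_space" unfolding y1_def
        by (rule hyp_normalize_segment_hyp_space[OF hx(1) y(1) t(1,2)])
    have y1\<rho>: "y1 \<in> hyperplane_H \<rho>" using y1 t(3) by (simp add: hyperplane_H_def lor_y1)
    have y1\<nu>: "\<epsilon> * lor y1 \<nu> > 0"
    proof -
      have "\<epsilon> * lor y1 \<nu> = t / c * (\<epsilon> * lor y \<nu>)" by (simp add: lor_y1 lor_segment hx)
      also have "\<dots> > 0" using \<open>t > 0\<close> c y(3) by simp
      finally show ?thesis .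
    qed
    \<comment> \<open>Another wall \<open>\<omega>\<close> would be crossed at a time
      \<open>q * t \<le> t\<close>; minimality of \<open>t\<close> forces equality, so that
      \<open>y1\<close> lies on both \<open>\<omega>\<close> and \<open>\<rho>\<close>.\<close>
    have "separating x y1 \<subseteq> {\<nu>, \<rho>}"
    proof (rule subsetI, rule ccontr)
      fix \<omega> assume \<omega>: "\<omega> \<in> separating x y1" "\<omega> \<notin> {\<nu>, \<rho>}"
      have "(lor x \<omega> > 0) \<noteq> (lor (segment x y t) \<omega> > 0)"
        using \<omega>(1) c by (simp add: separating_def lor_y1 zero_less_divide_iff)
      then obtain q where q: "0 \<le> q" "q \<le> 1" "(1 - q) * lor x \<omega> + q * lor (segment x y t) \<omega> = 0"
        by (rule linear_sign_change)
      have qt: "lor (segment x y (q * t)) \<omega> = 0" using q(3) by (simp add: lor_segment algebra_simps)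
      have "0 \<le> q * t" "q * t \<le> t" "q * t \<le> 1"
        using q t by (simp_all add: mult_left_le_one_le mult_le_one)
      then have "\<omega> \<in> E" using \<omega> qt by (auto simp: E_def separating_def)
      then have "t \<le> q * t" using \<tau>_unique[OF _ qt] fin by (simp add: t_def \<rho>(2))
      then have "q * t = t" using \<open>q * t \<le> t\<close> by (rule order_antisym[rotated])
      with qt have "lor (segment x y t) \<omega> = 0" by metis
      then have "y1 \<in> hyperplane_H \<omega>" using y1 by (simp add: hyperplane_H_def lor_y1)
      then show False using disjoint[OF _ \<rho>N(1), of \<omega>] y1\<rho> \<omega> by (auto simp: separating_def)
    qed
    then have "tensor_eval k (primitive y1) z = tensor_eval k (primitive x) z
        + (\<Sum>\<omega>\<in>{\<nu>, \<rho>}. (heaviside (lor y1 \<omega>) - heaviside (lor x \<omega>)) * tensor_eval k (zonal_tensor k \<omega>) z)" for z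
      using \<nu> \<rho>N by (intro primitive_step hx y1) auto
    moreover have "heaviside (lor y1 \<nu>) = heaviside \<epsilon>" using y1\<nu> \<epsilon> by (auto simp: heaviside_def)
    moreover have "lor y1 \<rho> = 0" using y1\<rho> by (simp add: hyperplane_H_def)
    \<comment> \<open>At \<open>y1\<close>, a point of the wall of \<open>\<rho>\<close>, the
      primitive has the value of the negative side; if \<open>x\<close> is on the positive side, the
      jump is added back.\<close>
    ultimately have P_eq: "tensor_eval k P z
        = tensor_eval k (primitive y1) z + heaviside (lor x \<rho>) * tensor_eval k (zonal_tensor k \<rho>) z" for z
      using \<rho>N(2) hx by (simp add: P heaviside_def)
    \<comment> \<open>The geodesic in direction \<open>b\<close> stays in the wall of
      \<open>\<rho>\<close>, where both terms of \<open>P_eq\<close> are constant because they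
      depend only on the level.\<close>
    obtain b where b: "lor b b = 1" "lor b y1 = 0" "lor b \<rho> = 0"
      by (rule exists_unit_orthogonal[OF dim y1])
    have "tensor_eval k P (geodesic y1 b u) = tensor_eval k P y1" if "u > 0" for u
    proof -
      have "geodesic y1 b u \<in> hyp_space" "lor (geodesic y1 b u) \<rho> = lor y1 \<rho>"
        using geodesic_hyp_space[OF y1 b(1,2) that] b \<open>lor y1 \<rho> = 0\<close> by (simp_all add: lor_geodesic)
      with primitive_depends_on_level[OF \<rho>N(1) y1\<rho> _ y1] tensor_eval_zonal_tensor_cong[OF _ y1] show ?thesis
        unfolding P_eq by metis
    qed
    then show ?thesis using y1 b y1\<nu> by (intro exI[of _ y1] exI[of _ b]) auto
  next
    case False
    \<comment> \<open>With no wall on this side, only \<open>\<nu>\<close> can separate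
      \<open>x\<close> from a point of the open half-space, so \<open>P\<close> is the value
      throughout it.\<close>
    have primitive_eq: "tensor_eval k P z
        = tensor_eval k (primitive y) z" if y: "y \<in> hyp_space" "\<epsilon> * lor y \<nu> > 0" for y z
    proof -
      have "separating x y \<subseteq> {\<nu>}"
      proof (rule subsetI, rule ccontr)
        fix \<omega> assume \<omega>: "\<omega> \<in> separating x y" "\<omega> \<notin> {\<nu>}"
        then obtain t where t: "0 \<le> t" "t \<le> 1" "lor (segment x y t) \<omega> = 0"
            by (blast elim: separating_crossing)
        have "\<omega> \<in> N" using \<omega> by (simp add: separating_def)
        then have "t \<noteq> 0" using t(3) ne[of \<omega>] \<omega>(2) by (auto simp: lor_segment)
        note tl = segment_timelike[OF hx(1) y(1) t(1,2)]
        have "\<epsilon> * lor (hyp_normalize (segment x y t)) \<nu>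
            = t / sqrt (- lor (segment x y t) (segment x y t)) * (\<epsilon> * lor y \<nu>)"
          by (simp add: lor_hyp_normalize_left lor_segment hx)
        also have "\<dots> > 0" using \<open>t \<noteq> 0\<close> t(1) tl by (intro mult_pos_pos[OF divide_pos_pos y(2)]) auto
        finally show False
          using False hyp_normalize_segment_hyp_space[OF hx(1) y(1) t(1,2)] \<open>\<omega> \<in> N\<close> t(3) tl
          by (auto simp: lor_hyp_normalize_eq_0_iff)
      qed
      then have "tensor_eval k (primitive y) z = tensor_eval k (primitive x) z
          + (\<Sum>\<omega>\<in>{\<nu>}. (heaviside (lor y \<omega>) - heaviside (lor x \<omega>)) * tensor_eval k (zonal_tensor k \<omega>) z)"
        using \<nu> by (intro primitive_step hx y) auto
      moreover have "heaviside (lor y \<nu>) = heaviside \<epsilon>" using y(2) \<epsilon> by (auto simp: heaviside_def)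
      ultimately show ?thesis using hx by (simp add: P heaviside_def)
    qed
    \<comment> \<open>A point on the perpendicular at \<open>x\<close>, on the side
      \<open>\<epsilon>\<close>; the parameter 2 gives the level
      \<open>(2 - 1 / 2) / 2 = 3 / 4\<close> up to sign.\<close>
    define a where "a = geodesic x (\<epsilon> *\<^sub>R \<nu>) 2"
    have e2: "\<epsilon> * \<epsilon> = 1" using \<epsilon> by auto
    have a: "a \<in> hyp_space"
      unfolding a_def using hx unit[OF \<nu>] e2
      by (intro geodesic_hyp_space) (simp_all add: lor_simps lor_commute[of \<nu> x])
    have a\<nu>: "\<epsilon> * lor a \<nu> = 3 / 4"
      using hx unit[OF \<nu>] e2 by (simp add: a_def lor_geodesic lor_simps)
    \<comment> \<open>As \<open>b\<close> is orthogonal to \<open>\<nu>\<close>, the geodesic from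
      \<open>a\<close> stays in the half-space, where \<open>primitive_bounded\<close> with
      \<open>s = 0\<close> and \<open>r = 1\<close> bounds \<open>P\<close>.\<close>
    obtain b where b: "lor b b = 1" "lor b a = 0" "lor b \<nu> = 0"
      by (rule exists_unit_orthogonal[OF dim a])
    obtain C where C: "\<And>x \<mu>. x \<in> hyp_space \<Longrightarrow> \<mu> \<in> insert 0 N \<Longrightarrow> lor x \<mu> = 0 \<Longrightarrow>
       \<bar>tensor_eval k (primitive x) (0 *\<^sub>R \<mu> + 1 *\<^sub>R x)\<bar> \<le> C" using primitive_bounded[of 0 1] by blast
    have "\<bar>tensor_eval k P (0 + 1 *\<^sub>R geodesic a b u)\<bar> \<le> C" if "u > 0" for u
    proof -
      have geodesic: "geodesic a b u \<in> hyp_space" by (rule geodesic_hyp_space[OF a b(1,2) that])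
      have "\<epsilon> * lor (geodesic a b u) \<nu> = (u + 1 / u) / 2 * (\<epsilon> * lor a \<nu>)"
          by (simp add: lor_geodesic b(3))
      also have "\<dots> > 0" using that unfolding a\<nu> by (simp add: add_pos_pos)
      finally have "tensor_eval k P (geodesic a b u)
          = tensor_eval k (primitive (geodesic a b u)) (geodesic a b u)" by (intro primitive_eq geodesic)
      then show ?thesis using C[OF geodesic, of 0] by (simp add: lor_inner)
    qed
    from tensor_eval_bounded_on_geodesic_imp_const[OF this] have "tensor_eval k P (geodesic a b u)
        = tensor_eval k P a" if "u > 0" for u
      using that by simp
    then show ?thesis using a b a\<nu> by (intro exI[of _ a] exI[of _ b]) auto
  qed
  then obtain a b where ab: "a \<in> hyp_space" "lor b b = 1" "lor b a = 0" "lor a \<nu> \<noteq> 0"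
    "\<And>u. u > 0 \<Longrightarrow> tensor_eval k P (geodesic a b u) = tensor_eval k P a" by blast
  have "tensor_eval k P y = tensor_eval k P a" if "y \<in> hyp_space" for y
    by (rule tensor_eval_const_if_const_on_geodesic[OF unit[OF \<nu>] P_level ab(1-4) ab(5) that])
  then show ?thesis using that unfolding P by blast
qed

lemma degree_zero: "k = 0"
proof (rule ccontr)
  assume "k \<noteq> 0"
  obtain \<nu> where \<nu>: "\<nu> \<in> N" using nonempty by blast
  obtain x where x: "x \<in> hyperplane_H \<nu>" by (rule hyperplane_nonempty[OF unit[OF \<nu>]])
  obtain \<kappa>1 where "\<And>y. y \<in> hyp_space
      \<Longrightarrow> tensor_eval k (primitive x) y + heaviside 1 * tensor_eval k (zonal_tensor k \<nu>) y = \<kappa>1"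
    using side_const[OF \<nu> x, of 1] by blast
  moreover obtain \<kappa>2 where "\<And>y. y \<in> hyp_space
      \<Longrightarrow> tensor_eval k (primitive x) y + heaviside (- 1) * tensor_eval k (zonal_tensor k \<nu>) y = \<kappa>2"
    using side_const[OF \<nu> x, of "- 1"] by blast
  ultimately have "\<forall>y\<in>hyp_space. tensor_eval k (zonal_tensor k \<nu>) y = \<kappa>1 - \<kappa>2"
    by (force simp: heaviside_def)
  then show False using zonal_not_const[OF unit[OF \<nu>]] \<open>k \<noteq> 0\<close> by simp
qed

end

lemma (in hyperplane_action) H1_nonzero_degree:
  assumes "k \<ge> 1" shows "H1_nonzero G k"
proof -
  obtain \<nu> where \<nu>: "\<nu> \<in> N" using nonempty by blast
  obtain x0 where "x0 \<in> hyperplane_H \<nu>" by (rule hyperplane_nonempty[OF unit[OF \<nu>]])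
  then have x0: "x0 \<in> hyp_space" by (simp add: hyperplane_H_def)
  have "\<not> (\<forall>A\<in>G. crossing_sum k x0 (A *v x0) = (\<lambda>f. tensor_act k A v f - v f))" for v
  proof
    assume "\<forall>A\<in>G. crossing_sum k x0 (A *v x0) = (\<lambda>f. tensor_act k A v f - v f)"
    then interpret trivialized_cocycle G N k x0 v by unfold_locales (use x0 in auto)
    show False using degree_zero assms by simp
  qed
  then show ?thesis unfolding H1_nonzero_def
    by (intro exI[of _ "\<lambda>A. crossing_sum k x0 (A *v x0)"]) (auto simp: crossing_sum_sym_trfree crossing_sum_cocycle x0)
qed

subsection \<open>Translates of the hypersurface\<close>

text \<open>Two of the uncountably many points of the segment lie on the same hyperplane, which
  therefore contains the whole segment.\<close>

lemma segment_in_hyperplane: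
  assumes fin: "\<And>K. compact K \<Longrightarrow> finite {hyperplane_H \<nu> |\<nu>. \<nu> \<in> N \<and> hyperplane_H \<nu> \<inter> K \<noteq> {}}"
    and x: "x \<in> hyp_space" and y: "y \<in> hyp_space"
    and cover: "\<And>t. 0 \<le> t \<Longrightarrow> t \<le> 1 \<Longrightarrow> hyp_normalize (segment x y t) \<in> (\<Union>\<nu>\<in>N. hyperplane_H \<nu>)"
  obtains \<nu> where "\<nu> \<in> N" "x \<in> hyperplane_H \<nu>" "y \<in> hyperplane_H \<nu>"
proof -
  obtain L where L: "compact L" "\<And>t. 0 \<le> t \<Longrightarrow> t \<le> 1 \<Longrightarrow> hyp_normalize (segment x y t) \<in> L"
    by (rule compact_join[of "{x, y}"]) (use x y in auto)
  have "\<forall>t\<in>{0..1}. \<exists>\<nu>. \<nu> \<in> N \<and> hyp_normalize (segment x y t) \<in> hyperplane_H \<nu>" using cover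
      by (simp add: Bex_def)
  from bchoice[OF this] obtain h where
    h: "\<And>t. t \<in> {0..1} \<Longrightarrow> h t \<in> N \<and> hyp_normalize (segment x y t) \<in> hyperplane_H (h t)" by blast
  have "(\<lambda>t. hyperplane_H (h t)) ` {0..1} \<subseteq> {hyperplane_H \<nu> |\<nu>. \<nu> \<in> N \<and> hyperplane_H \<nu> \<inter> L \<noteq> {}}"
  proof (rule image_subsetI)
    fix t :: real assume t: "t \<in> {0..1}"
    then have "hyp_normalize (segment x y t) \<in> hyperplane_H (h t) \<inter> L"
        using h[OF t] L(2)[of t] by simp
    then show "hyperplane_H (h t) \<in> {hyperplane_H \<nu> |\<nu>. \<nu> \<in> N \<and> hyperplane_H \<nu> \<inter> L \<noteq> {}}"
      using h[OF t] by blast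
  qed
  then have "finite ((\<lambda>t. hyperplane_H (h t)) ` {0..1})"
    using fin[OF L(1)] by (rule finite_subset)
  moreover have "infinite {0..1::real}" by (simp add: infinite_Icc)
  ultimately have "\<not> inj_on (\<lambda>t. hyperplane_H (h t)) {0..1}" by (metis finite_imageD)
  then obtain t t' where t: "t \<in> {0..1}" "t' \<in> {0..1}" "t \<noteq> t'"
    and "hyperplane_H (h t) = hyperplane_H (h t')" unfolding inj_on_def by blast
  define \<nu> where "\<nu> = h t"
  have "hyp_normalize (segment x y t) \<in> hyperplane_H \<nu>"
      "hyp_normalize (segment x y t') \<in> hyperplane_H \<nu>"
    using h[OF t(1)] h[OF t(2)] \<open>hyperplane_H (h t) = hyperplane_H (h t')\<close> by (simp_all add: \<nu>_def)
  then have z: "lor (segment x y t) \<nu> = 0" "lor (segment x y t') \<nu> = 0"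
    using x y t by (simp_all add: hyp_normalize_segment_in_hyperplane)
  have "(t - t') * (lor y \<nu> - lor x \<nu>) = lor (segment x y t) \<nu> - lor (segment x y t') \<nu>"
    by (simp add: lor_segment algebra_simps)
  then have "lor y \<nu> = lor x \<nu>" using z t(3) by simp
  moreover from this have "lor x \<nu> = 0" using z(1) by (simp add: lor_segment algebra_simps)
  ultimately show ?thesis using that[of \<nu>] h[OF t(1)] x y by (simp add: \<nu>_def hyperplane_H_def)
qed

text \<open>The hypersurface supplies an invariant union of hyperplanes, whereas
  \<open>hyperplane_action\<close> asks for an invariant family of normals, one for each wall. Most
  of the proof passes from one to the other.\<close>

theorem theorem5p6:
  fixes \<Gamma> :: "('n::finite) mat1 set" and S :: "'n vec1 set"
  assumes "CARD('n) \<ge> 2"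
    and "is_subgroup_mat \<Gamma>" and "\<Gamma> \<subseteq> SO0_n1"
    and "discrete_mat \<Gamma>" and "torsion_free \<Gamma>" and "cocompact \<Gamma>"
    and "orientable_compact_tg_hypersurface \<Gamma> S"
  shows "\<forall>k\<ge>1. H1_nonzero \<Gamma> k"
proof -
  obtain N where "N \<noteq> {}" and unit: "\<forall>\<nu>\<in>N. lor \<nu> \<nu> = 1"
    and S: "S = (\<Union>\<nu>\<in>N. hyperplane_H \<nu>)"
    and \<Gamma>_S: "\<forall>A\<in>\<Gamma>. (\<lambda>x. A *v x) ` S = S"
    and disj: "\<forall>\<nu>\<in>N. \<forall>\<mu>\<in>N. hyperplane_H \<nu> = hyperplane_H \<mu> \<or>
       hyperplane_H \<nu> \<inter> hyperplane_H \<mu> = {}"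
    and fin: "\<forall>K. compact K \<longrightarrow> finite {hyperplane_H \<nu> |\<nu>. \<nu> \<in> N \<and> hyperplane_H \<nu> \<inter> K \<noteq> {}}"
    and two_sided: "\<forall>A\<in>\<Gamma>. \<forall>\<nu>\<in>N.
       (\<lambda>x. A *v x) ` hyperplane_H \<nu> = hyperplane_H \<nu> \<longrightarrow> A *v \<nu> = \<nu>"
    using assms(7) unfolding orientable_compact_tg_hypersurface_def by (elim exE conjE) (rule that)
  note unit = unit[rule_format] and \<Gamma>_S = \<Gamma>_S[rule_format] and disj = disj[rule_format]
    and fin = fin[rule_format] and two_sided = two_sided[rule_format]
  obtain K where K: "compact K" "K \<subseteq> hyp_space" "(\<Union>A\<in>\<Gamma>. (\<lambda>x. A *v x) ` K) = hyp_space"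
    using assms(6) unfolding cocompact_def by blast
  have lorentz: "lor (A *v x) (A *v y) = lor x y" if "A \<in> \<Gamma>" for A x y
    using assms(3) that connected_component_subset[of SO_n1 "mat 1 :: 'n mat1"]
    unfolding SO0_n1_def SO_n1_def by blast
  obtain \<nu>0 where \<nu>0: "\<nu>0 \<in> N" using \<open>N \<noteq> {}\<close> by blast
  have mult: "A ** B \<in> \<Gamma>" if "A \<in> \<Gamma>" "B \<in> \<Gamma>" for A B
    using assms(2) that unfolding is_subgroup_mat_def by blast
  have inverse: "\<exists>B\<in>\<Gamma>. (\<forall>x. A *v (B *v x) = x) \<and> (\<forall>x. B *v (A *v x) = x)" if "A \<in> \<Gamma>" for A
  proof -
    have A: "invertible A" "matrix_inv A \<in> \<Gamma>"
      using assms(2) that unfolding is_subgroup_mat_def by blast+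
    have "A ** matrix_inv A = mat 1 \<and> matrix_inv A ** A = mat 1"
      unfolding matrix_inv_def by (rule someI_ex) (use A(1) in \<open>simp add: invertible_def\<close>)
    then show ?thesis using A(2) by (intro bexI[of _
        "matrix_inv A"]) (simp_all add: matrix_vector_mul_assoc)
  qed
  \<comment> \<open>Cocompactness places \<open>A *v y\<close> on the upper sheet for every
    \<open>y\<close> in \<open>K\<close>; since \<open>lor\<close> is preserved,
    \<open>A *v x\<close> is on the same sheet.\<close>
  have hyp: "A *v x \<in> hyp_space" if A: "A \<in> \<Gamma>" and x: "x \<in> hyp_space" for A x
  proof -
    obtain y where y: "y \<in> K" using x K(3) by blast
    then have "A *v y \<in> hyp_space" "y \<in> hyp_space" using A K by blast+
    then show ?thesis
      using lor_neg[OF x, of y] hyp_spaceD(1)[OF x]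
      by (intro hyp_spaceI[OF _ \<open>A *v y \<in> hyp_space\<close>]) (simp_all add: lorentz[OF A])
  qed
  have hyper: "A *v x \<in> hyperplane_H (A *v \<nu>)" if "A \<in> \<Gamma>" "x \<in> hyperplane_H \<nu>" for A x \<nu>
    using that by (simp add: hyperplane_H_def hyp lorentz)
  have image_H: "(\<lambda>x. A *v x) ` hyperplane_H \<nu> = hyperplane_H (A *v \<nu>)" if A: "A \<in> \<Gamma>" for A \<nu>
  proof -
    obtain B where B: "B \<in> \<Gamma>" "\<And>x. A *v (B *v x) = x" "\<And>x. B *v (A *v x) = x"
      using inverse[OF A] by blast
    have "y \<in> (\<lambda>x. A *v x) ` hyperplane_H \<nu>" if "y \<in> hyperplane_H (A *v \<nu>)" for y
      using hyper[OF B(1) that] B by (intro image_eqI[of _ _ "B *v y"]) simp_all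
    then show ?thesis using hyper[OF A] by auto
  qed
  \<comment> \<open>Invariance is given only for the union \<open>S\<close>. A chord between two
    points of the translated hyperplane projects into \<open>S\<close>, so one hyperplane of the
    family contains both ends; by disjointness it is always the one through
    \<open>x\<close>.\<close>
  have sub: "\<exists>\<mu>\<in>N. hyperplane_H (A *v \<nu>) \<subseteq> hyperplane_H \<mu>" if A: "A \<in> \<Gamma>" and \<nu>: "\<nu> \<in> N" for A \<nu>
  proof -
    have in_S: "hyperplane_H (A *v \<nu>) \<subseteq> S"
      unfolding image_H[OF A, symmetric] using \<Gamma>_S[OF A] \<nu> S by blast
    obtain x where x: "x \<in> hyperplane_H (A *v \<nu>)"
      by (rule hyperplane_nonempty[of "A *v \<nu>"]) (use unit[OF \<nu>] lorentz[OF A] in auto)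
    then obtain \<mu> where \<mu>: "\<mu> \<in> N" "x \<in> hyperplane_H \<mu>" using in_S S by blast
    have "y \<in> hyperplane_H \<mu>" if y: "y \<in> hyperplane_H (A *v \<nu>)" for y
    proof -
      have h: "x \<in> hyp_space" "y \<in> hyp_space" "lor x (A *v \<nu>) = 0" "lor y (A *v \<nu>) = 0"
        using x y by (auto simp: hyperplane_H_def)
      have "hyp_normalize (segment x y t) \<in> hyperplane_H (A *v \<nu>)" if "0 \<le> t" "t \<le> 1" for t
        using that h by (simp add: hyp_normalize_segment_in_hyperplane lor_segment)
      then have "hyp_normalize (segment x y t) \<in> (\<Union>\<nu>\<in>N. hyperplane_H \<nu>)" if "0 \<le> t" "t \<le> 1" for t
        using that in_S S by blast
      then obtain \<rho> where "\<rho> \<in> N" "x \<in> hyperplane_H \<rho>" "y \<in> hyperplane_H \<rho>"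
        using segment_in_hyperplane[OF fin h(1,2)] by blast
      then show ?thesis using disj[OF \<mu>(1), of \<rho>] \<mu>(2) by blast
    qed
    then show ?thesis using \<mu>(1) by blast
  qed
  \<comment> \<open>The inclusions for \<open>A\<close> and its inverse put the hyperplane of
    \<open>\<nu>\<close> inside a member of the family, which by disjointness equals it; hence the
    inclusion for \<open>A\<close> is an equality.\<close>
  have translate: "\<exists>\<mu>\<in>N. hyperplane_H (A *v \<nu>)
      = hyperplane_H \<mu>" if A: "A \<in> \<Gamma>" and \<nu>: "\<nu> \<in> N" for A \<nu>
  proof -
    obtain B where B: "B \<in> \<Gamma>" "\<And>x. A *v (B *v x) = x" "\<And>x. B *v (A *v x) = x"
      using inverse[OF A] by blast
    obtain \<mu> where \<mu>: "\<mu> \<in> N" "hyperplane_H (A *v \<nu>) \<subseteq> hyperplane_H \<mu>" using sub[OF A \<nu>] by blast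
    obtain \<rho> where \<rho>: "\<rho> \<in> N" "hyperplane_H (B *v \<mu>) \<subseteq> hyperplane_H \<rho>" using sub[OF B(1) \<mu>(1)]
        by blast
    have sub1: "hyperplane_H \<nu> \<subseteq> hyperplane_H \<rho>"
    proof
      fix z assume "z \<in> hyperplane_H \<nu>"
      then have "B *v (A *v z) \<in> hyperplane_H (B *v \<mu>)" using hyper A B(1) \<mu>(2) by blast
      then show "z \<in> hyperplane_H \<rho>" using B(3) \<rho>(2) by auto
    qed
    obtain z where "z \<in> hyperplane_H \<nu>" by (rule hyperplane_nonempty[OF unit[OF \<nu>]])
    then have "hyperplane_H \<nu> = hyperplane_H \<rho>" using disj[OF \<nu> \<rho>(1)] sub1 by blast
    then have "y \<in> hyperplane_H (A *v \<nu>)" if "y \<in> hyperplane_H \<mu>" for y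
      using hyper[OF A, of "B *v y" \<nu>] hyper[OF B(1) that] \<rho>(2) B(2) by auto
    then show ?thesis using \<mu> by blast
  qed
  \<comment> \<open>\<open>N\<close> may list both normals of a hyperplane and need not be invariant
    as a set of vectors. The orbit of one normal is invariant, and two-sidedness leaves one normal
    per wall in it.\<close>
  define M where "M = (\<lambda>A. A *v \<nu>0) ` \<Gamma>"
  \<comment> \<open>If \<open>A\<close> and \<open>B\<close> send \<open>\<nu>0\<close> to normals
    of one hyperplane, then \<open>B' ** A\<close> stabilizes the hyperplane of
    \<open>\<nu>0\<close> and so fixes \<open>\<nu>0\<close>.\<close>
  have H_inj: "\<mu> = \<rho>" if M: "\<mu> \<in> M" "\<rho> \<in> M" "hyperplane_H \<mu> = hyperplane_H \<rho>" for \<mu> \<rho>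
  proof -
    obtain A B where A: "A \<in> \<Gamma>" "\<mu> = A *v \<nu>0" and B: "B \<in> \<Gamma>" "\<rho> = B *v \<nu>0"
      using M(1,2) unfolding M_def by blast
    obtain B' where B': "B' \<in> \<Gamma>" "\<And>x. B *v (B' *v x) = x" "\<And>x. B' *v (B *v x) = x"
      using inverse[OF B(1)] by blast
    have "hyperplane_H ((B' ** A) *v \<nu>0) = (\<lambda>x. B' *v x) ` hyperplane_H \<mu>"
      by (simp add: image_H[OF B'(1)] A(2) matrix_vector_mul_assoc)
    also have "\<dots> = hyperplane_H \<nu>0"
      by (simp add: M(3) image_H[OF B'(1)] B(2) B'(3))
    finally have "(B' ** A) *v \<nu>0 = \<nu>0"
      using two_sided[OF mult[OF B'(1) A(1)] \<nu>0] image_H[OF mult[OF B'(1) A(1)], of \<nu>0] by simp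
    then have "B *v (B' *v \<mu>) = \<rho>" by (simp add: A(2) B(2) matrix_vector_mul_assoc)
    then show ?thesis by (simp add: B'(2))
  qed
  have M_N: "\<exists>\<rho>\<in>N. hyperplane_H \<mu> = hyperplane_H \<rho>" if "\<mu> \<in> M" for \<mu>
    using that translate \<nu>0 by (auto simp: M_def)
  interpret hyperplane_action \<Gamma> M
  proof
    show "CARD('n) \<ge> 2" by fact
    show "M \<noteq> {}" using assms(2) by (auto simp: M_def is_subgroup_mat_def)
    show "lor \<nu> \<nu> = 1" if "\<nu> \<in> M" for \<nu>
      using that unit[OF \<nu>0] by (auto simp: M_def lorentz)
    show "A *v \<nu> \<in> M" if "A \<in> \<Gamma>" "\<nu> \<in> M" for A \<nu>
      using that mult by (auto simp: M_def matrix_vector_mul_assoc)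
    show "hyperplane_H \<mu> \<inter> hyperplane_H \<nu> = {}" if "\<mu> \<in> M" "\<nu> \<in> M" "\<mu> \<noteq> \<nu>" for \<mu> \<nu>
      using M_N[OF that(1)] M_N[OF that(2)] H_inj[OF that(1,2)] that(3) disj by metis
    show "finite {\<nu> \<in> M. hyperplane_H \<nu> \<inter> K' \<noteq> {}}" if "compact K'" for K'
    proof (rule inj_on_finite[OF _ _ fin[OF that]])
      show "inj_on hyperplane_H {\<nu> \<in> M. hyperplane_H \<nu> \<inter> K' \<noteq> {}}"
        using H_inj by (auto intro: inj_onI)
      show "hyperplane_H ` {\<nu> \<in> M. hyperplane_H \<nu> \<inter> K' \<noteq> {}}
          \<subseteq> {hyperplane_H \<nu> |\<nu>. \<nu> \<in> N \<and> hyperplane_H \<nu> \<inter> K' \<noteq> {}}"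
        using M_N by force
    qed
    show "\<exists>K. compact K \<and> K \<subseteq> hyp_space \<and> (\<forall>x\<in>hyp_space. \<exists>A\<in>\<Gamma>. \<exists>y\<in>K. x = A *v y)"
      using K by (intro exI[of _ K]) blast
  qed (simp_all add: lorentz hyp inverse)
  show ?thesis using H1_nonzero_degree by blast
qed

end
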